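(* Let $h\geq 2$ be an integer, let $m_0=2h(2h-1)$, $m_1=(2h+1)(2h-1)$, $m_2=2h(2h+1)$, $m_3=2h(2h+1)+(2h-1)$, let $\Gamma_h=\langle m_0,m_1,m_2,m_3\rangle$ be the numerical semigroup they generate, let $K$ be a field, let $R=K[[t^{m_0},t^{m_1},t^{m_2},t^{m_3}]]$ with maximal ideal $\mathfrak{m}$, and let $I=\langle t^{m_0}\rangle\subset R$. The tangent cone $G_{\mathfrak{m}}(\Gamma_h)$ of $\Gamma_h$ is a free $F(I)$-module. Moreover, $$G_{\mathfrak{m}}(\Gamma_h)=\bigoplus_{k=1}^{2h-2}\bigl(F(I)(-k)\bigr)^{2k+1}\oplus\bigl(F(I)(-(2h-1))\bigr)^{2h-1}.$$
   Context: The tangent cone is the associated graded ring $G_{\mathfrak{m}}(\Gamma_h)=\bigoplus_{n\geq 0}\mathfrak{m}^n/\mathfrak{m}^{n+1}$ of $R$. The fiber cone of $I$ is $F(I)=\bigoplus_{n\geq 0}I^n/\mathfrak{m}I^n$, a graded ring isomorphic to the polynomial ring $K[T]$ in one variable of degree $1$; $G_{\mathfrak{m}}(\Gamma_h)$ is a graded $F(I)$-module with $T$ acting as multiplication by the class of $t^{m_0}$ in $\mathfrak{m}/\mathfrak{m}^2$. For a graded module $N$, $N(-d)$ denotes the shift with $N(-d)_n=N_{n-d}$, and exponents denote direct-sum powers. The displayed equality is to be read as an isomorphism of graded $F(I)$-modules.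
   Formalization: The direct sum is taken from k=0 instead of k=1, adding one summand F(I): as printed the right-hand side vanishes in degree 0, whereas the degree-0 part of the tangent cone is R/m = K, so the printed equality is false. *)

theory Defs
  imports
    "HOL-Computational_Algebra.Formal_Power_Series"
    "HOL-Algebra.Ideal_Product"
    "HOL-Algebra.QuotRing"
    "Jordan_Normal_Form.Missing_VectorSpace"
begin

text \<open>
  \<open>K[[t^m\<^sub>1, \<dots>, t^m\<^sub>r]]\<close> as a subring of \<open>K[[t]]\<close>: the image of the substitution
  \<open>K[[x\<^sub>1, \<dots>, x\<^sub>r]] \<rightarrow> K[[t]]\<close>, \<open>x\<^sub>i \<mapsto> t^m\<^sub>i\<close>. A power series in \<open>r\<close> variables is given by its
  coefficients \<open>c\<close>, indexed by exponent lists of length \<open>r\<close>. The generators are meant to be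
  positive, so that the sums below are over finite sets.
\<close>

definition power_series_subring :: "nat list \<Rightarrow> 'a::field fps ring" where
  "power_series_subring ms =
     \<lparr>carrier = {f. \<exists>c :: nat list \<Rightarrow> 'a. \<forall>n. fps_nth f n =
         (\<Sum>e | length e = length ms \<and> (\<Sum>i<length ms. e ! i * ms ! i) = n. c e)},
      monoid.mult = (*), one = 1, zero = 0, add = (+)\<rparr>"

abbreviation ideal_power :: "('a, 'b) ring_scheme \<Rightarrow> 'a set \<Rightarrow> nat \<Rightarrow> 'a set" where
  "ideal_power R J n \<equiv> J [^]\<^bsub>ideals_set R\<^esub> n"

text \<open>
  Graded modules are \<open>\<nat>\<close>-graded; the components in negative degrees are zero.
\<close>

record ('a, 'b) graded_module = "('a, 'b) module" +
  component :: "nat \<Rightarrow> 'b set"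

text \<open>
  For ideals \<open>B n \<subseteq> A n\<close> of \<open>R\<close>, elements of \<open>\<Oplus>\<^sub>n A n / B n\<close> are sequences of cosets
  \<open>x n \<in> A n / B n\<close>, almost all of them zero (that is, equal to \<open>B n\<close>).
  If \<open>x\<close> and \<open>y\<close> are such sequences, for possibly different families of quotients, then
  the product of the class of \<open>a\<close> in degree \<open>i\<close> with the class of \<open>b\<close> in degree \<open>j\<close> is the class of
  \<open>a b\<close> modulo \<open>B (i + j)\<close>. The same formula thus gives the multiplication of the fiber cone, that of
  the tangent cone, and the action of the fiber cone on the tangent cone.
\<close>

definition graded_product ::
    "('a, 'b) ring_scheme \<Rightarrow> (nat \<Rightarrow> 'a set) \<Rightarrow> (nat \<Rightarrow> 'a set) \<Rightarrow> (nat \<Rightarrow> 'a set) \<Rightarrow> nat \<Rightarrow> 'a set" where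
  "graded_product R B x y =
     (\<lambda>n. \<Oplus>\<^bsub>R Quot B n\<^esub> i \<in> {..n}. rcoset_mult R (B n) (x i) (y (n - i)))"

definition graded_quotient ::
    "('a, 'b) ring_scheme \<Rightarrow> (nat \<Rightarrow> 'a set) \<Rightarrow> (nat \<Rightarrow> 'a set) \<Rightarrow>
      (nat \<Rightarrow> 'a set, nat \<Rightarrow> 'a set) graded_module" where
  "graded_quotient R A B =
     (let C = {x. (\<forall>n. x n \<in> (\<lambda>a. B n +>\<^bsub>R\<^esub> a) ` A n) \<and> finite {n. x n \<noteq> B n}} in
      \<lparr>carrier = C,
       monoid.mult = graded_product R B,
       one = (\<lambda>n. if n = 0 then B 0 +>\<^bsub>R\<^esub> \<one>\<^bsub>R\<^esub> else B n),
       zero = B,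
       add = (\<lambda>x y n. x n <+>\<^bsub>R\<^esub> y n),
       smult = graded_product R B,
       component = (\<lambda>n. {x \<in> C. \<forall>i. i \<noteq> n \<longrightarrow> x i = B i})\<rparr>)"

text \<open>
  \<open>F(I) = \<Oplus>\<^sub>n I\<^sup>n / \<mm> I\<^sup>n\<close>, viewed as a graded module over itself.
\<close>

definition fiber_cone ::
    "('a, 'b) ring_scheme \<Rightarrow> 'a set \<Rightarrow> 'a set \<Rightarrow> (nat \<Rightarrow> 'a set, nat \<Rightarrow> 'a set) graded_module" where
  "fiber_cone R \<mm> I =
     graded_quotient R (\<lambda>n. ideal_power R I n) (\<lambda>n. \<mm> \<cdot>\<^bsub>R\<^esub> ideal_power R I n)"

text \<open>
  \<open>\<Oplus>\<^sub>n \<mm>\<^sup>n / \<mm>\<^sup>n\<^sup>+\<^sup>1\<close>. Its scalar multiplication takes scalars from \<open>F(I)\<close> for \<open>I \<subseteq> \<mm>\<close>,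
  through the maps \<open>I\<^sup>n / \<mm> I\<^sup>n \<rightarrow> \<mm>\<^sup>n / \<mm>\<^sup>n\<^sup>+\<^sup>1\<close> induced by inclusion.
\<close>

definition tangent_cone ::
    "('a, 'b) ring_scheme \<Rightarrow> 'a set \<Rightarrow> (nat \<Rightarrow> 'a set, nat \<Rightarrow> 'a set) graded_module" where
  "tangent_cone R \<mm> = graded_quotient R (\<lambda>n. ideal_power R \<mm> n) (\<lambda>n. ideal_power R \<mm> (n + 1))"

definition graded_shift ::
    "('a, 'b, 'c) graded_module_scheme \<Rightarrow> nat \<Rightarrow> ('a, 'b, 'c) graded_module_scheme" where
  "graded_shift N d =
     N\<lparr>component := (\<lambda>n. if d \<le> n then component N (n - d) else {\<zero>\<^bsub>N\<^esub>})\<rparr>"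

definition graded_sum ::
    "('a, 'b) graded_module \<Rightarrow> ('a, 'c) graded_module \<Rightarrow> ('a, 'b \<times> 'c) graded_module" where
  "graded_sum M N =
     module.extend (direct_sum M N)
       (graded_module.fields (\<lambda>n. component M n \<times> component N n))"

text \<open>
  As in \<^const>\<open>direct_sum\<close>, the ring multiplication and unit of the record are irrelevant
  placeholders.
\<close>

definition graded_Sum ::
    "'i set \<Rightarrow> ('i \<Rightarrow> ('a, 'b) graded_module) \<Rightarrow> ('a, 'i \<Rightarrow> 'b) graded_module" where
  "graded_Sum J N =
     (let Z = (\<lambda>j\<in>J. \<zero>\<^bsub>N j\<^esub>);
          C = {x \<in> \<Pi>\<^sub>E j\<in>J. carrier (N j). finite {j \<in> J. x j \<noteq> \<zero>\<^bsub>N j\<^esub>}} in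
      \<lparr>carrier = C,
       monoid.mult = (\<lambda>x y. Z),
       one = Z,
       zero = Z,
       add = (\<lambda>x y. \<lambda>j\<in>J. x j \<oplus>\<^bsub>N j\<^esub> y j),
       smult = (\<lambda>a x. \<lambda>j\<in>J. a \<odot>\<^bsub>N j\<^esub> x j),
       component = (\<lambda>n. {x \<in> C. \<forall>j\<in>J. x j \<in> component (N j) n})\<rparr>)"

definition graded_power ::
    "('a, 'b) graded_module \<Rightarrow> nat \<Rightarrow> ('a, nat \<Rightarrow> 'b) graded_module" where
  "graded_power N r = graded_Sum {..<r} (\<lambda>_. N)"

definition graded_isomorphic ::
    "('a, 'r) ring_scheme \<Rightarrow> ('a, 'b) graded_module \<Rightarrow> ('a, 'c) graded_module \<Rightarrow> bool" where
  "graded_isomorphic F M N \<longleftrightarrow>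
     (\<exists>f \<in> module_hom F M N. bij_betw f (carrier M) (carrier N) \<and>
        (\<forall>n. f ` component M n = component N n))"

definition free_module :: "('a, 'r) ring_scheme \<Rightarrow> ('a, 'b, 'm) module_scheme \<Rightarrow> bool" where
  "free_module F M \<longleftrightarrow>
     module F M \<and>
     (\<exists>S \<subseteq> carrier M. module.gen_set F M S \<and> module.lin_indpt F M S)"

end

theory Submission
  imports
    Defs
    "HOL-Computational_Algebra.Polynomial"
    "HOL-Number_Theory.Cong"
begin

text \<open>
  Every ideal involved consists of all series supported in some set of exponents: \<open>\<mm>\<^sup>n\<close> in the set of
  sums of at least \<open>n\<close> generators. Every integer is uniquely \<open>k m\<^sub>0 + a (2h - 1) + b 4h\<close> with
  \<open>0 \<le> a < 2h\<close> and \<open>0 \<le> b < 2h - 1\<close>, and it lies in the semigroup if and only if \<open>max a b \<le> k\<close>. Since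
  \<open>2h (2h - 1) = m\<^sub>0\<close> and \<open>(2h - 1) 4h = 2 m\<^sub>0\<close>, reducing an arbitrary expression to this normal form
  can only increase \<open>k\<close>, so \<open>k\<close> is the order. Hence adding \<open>m\<^sub>0\<close> raises orders by exactly one, and the
  classes of the monomials with \<open>k = max a b\<close> form a basis over \<open>F(I) = K[T]\<close>. There are \<open>2k + 1\<close> such
  pairs \<open>(a, b)\<close> for \<open>k \<le> 2h - 2\<close>, and \<open>2h - 1\<close> for \<open>k = 2h - 1\<close>.
\<close>

section \<open>Power series with restricted support\<close>

definition supported :: "nat set \<Rightarrow> 'a::zero fps set" where
  "supported T = {f. \<forall>n. n \<notin> T \<longrightarrow> fps_nth f n = 0}"

lemma supportedI: "(\<And>n. n \<notin> T \<Longrightarrow> fps_nth f n = 0) \<Longrightarrow> f \<in> supported T"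
  by (simp add: supported_def)

lemma supportedD: "f \<in> supported T \<Longrightarrow> n \<notin> T \<Longrightarrow> fps_nth f n = 0"
  by (simp add: supported_def)

lemma supported_mono: "A \<subseteq> B \<Longrightarrow> supported A \<subseteq> supported B"
  by (auto simp: supported_def)

lemma supported_zero [simp]: "0 \<in> supported T"
  by (simp add: supported_def)

lemma supported_add:
  fixes f g :: "'a::monoid_add fps"
  shows "f \<in> supported T \<Longrightarrow> g \<in> supported T \<Longrightarrow> f + g \<in> supported T"
  by (simp add: supported_def)

lemma supported_uminus:
  fixes f :: "'a::group_add fps"
  shows "f \<in> supported T \<Longrightarrow> - f \<in> supported T"
  by (simp add: supported_def)

lemma supported_sum:
  fixes f :: "'i \<Rightarrow> 'a::comm_monoid_add fps"
  shows "(\<And>i. i \<in> A \<Longrightarrow> f i \<in> supported T) \<Longrightarrow> sum f A \<in> supported T"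
  by (induction A rule: infinite_finite_induct) (auto intro: supported_add)

lemma supported_mult:
  fixes f g :: "'a::semiring_0 fps"
  assumes "f \<in> supported A" "g \<in> supported B" "\<And>a b. a \<in> A \<Longrightarrow> b \<in> B \<Longrightarrow> a + b \<in> C"
  shows "f * g \<in> supported C"
proof (rule supportedI)
  fix n assume n: "n \<notin> C"
  have "fps_nth f i * fps_nth g (n - i) = 0" if "i \<in> {0..n}" for i
  proof (cases "i \<in> A \<and> n - i \<in> B")
    case True
    then show ?thesis using assms(3)[of i "n - i"] n that by simp
  next
    case False
    then show ?thesis using assms(1,2) by (auto dest: supportedD)
  qed
  then show "fps_nth (f * g) n = 0" by (simp add: fps_mult_nth)
qed

lemma fps_X_power_supported: "n \<in> T \<Longrightarrow> (fps_X ^ n :: 'a::comm_semiring_1 fps) \<in> supported T"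
  by (auto simp: supported_def fps_X_power_nth)

lemma supported_shift:
  assumes "f \<in> supported T" "\<And>n. n \<notin> T' \<Longrightarrow> n + k \<notin> T"
  shows "fps_shift k f \<in> supported T'"
  using assms by (auto simp: supported_def)

lemma fps_const_sum: "fps_const (sum f A) = (\<Sum>i\<in>A. fps_const (f i))"
  by (rule fps_ext) (simp add: fps_sum_nth)

section \<open>Rings of power series with exponents in a given set\<close>

definition series_ring :: "nat set \<Rightarrow> 'a::comm_ring_1 fps ring" where
  "series_ring S = \<lparr>carrier = supported S, monoid.mult = (*), one = 1, zero = 0, add = (+)\<rparr>"

lemma series_ring_simps [simp]:
  "carrier (series_ring S) = supported S"
  "x \<otimes>\<^bsub>series_ring S\<^esub> y = x * y"
  "\<one>\<^bsub>series_ring S\<^esub> = 1"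
  "\<zero>\<^bsub>series_ring S\<^esub> = 0"
  "x \<oplus>\<^bsub>series_ring S\<^esub> y = x + y"
  by (simp_all add: series_ring_def)

text \<open>Both records carry the operations of formal power series, so only the carriers have to
  be compared. A coefficient of the substituted series is a sum over the exponent lists of that
  weight: it vanishes if there are none, and is arbitrary otherwise.\<close>

lemma power_series_subring_eq:
  assumes pos: "\<And>i. i < length ms \<Longrightarrow> ms ! i > 0"
  shows "(power_series_subring ms :: 'a::field fps ring) =
    series_ring {n. \<exists>e. length e = length ms \<and> (\<Sum>i<length ms. e ! i * ms ! i) = n}"
proof -
  define E where "E n = {e. length e = length ms \<and> (\<Sum>i<length ms. e ! i * ms ! i) = n}" for n
  have fin: "finite (E n)" for n
  proof (rule finite_subset)
    show "E n \<subseteq> {e. set e \<subseteq> {..n} \<and> length e = length ms}"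
    proof
      fix e assume e: "e \<in> E n"
      have "e ! i \<le> n" if i: "i < length ms" for i
      proof -
        \<comment> \<open>Positive generators bound every entry of \<open>e\<close> by
          \<open>n\<close>, so the sum defining a coefficient is a genuine finite sum.\<close>
        have "e ! i \<le> e ! i * ms ! i" using pos[OF i] by simp
        also have "\<dots> \<le> (\<Sum>i<length ms. e ! i * ms ! i)"
          using i by (intro member_le_sum) auto
        finally show ?thesis using e by (simp add: E_def)
      qed
      then show "e \<in> {e. set e \<subseteq> {..n} \<and> length e = length ms}"
        using e by (auto simp: E_def in_set_conv_nth)
    qed
    show "finite {e. set e \<subseteq> {..n} \<and> length e = length ms}"
      by (rule finite_lists_length_eq) simp
  qed
  have "(\<exists>c :: nat list \<Rightarrow> 'a. \<forall>n. fps_nth f n = (\<Sum>e\<in>E n. c e)) \<longleftrightarrow>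
    f \<in> supported {n. E n \<noteq> {}}" for f
  proof
    assume "\<exists>c :: nat list \<Rightarrow> 'a. \<forall>n. fps_nth f n = (\<Sum>e\<in>E n. c e)"
    then show "f \<in> supported {n. E n \<noteq> {}}" by (auto simp: supported_def)
  next
    assume f: "f \<in> supported {n. E n \<noteq> {}}"
    \<comment> \<open>One list \<open>r n\<close> of each attainable weight carries the whole
      coefficient; all other lists get 0.\<close>
    define r where "r n = (SOME e. e \<in> E n)" for n
    define c where "c e = (let n = (\<Sum>i<length ms. e ! i * ms ! i) in
      if e = r n then fps_nth f n else 0)" for e
    have "fps_nth f n = (\<Sum>e\<in>E n. c e)" for n
    proof (cases "E n = {}")
      case True
      then show ?thesis using f by (simp add: supported_def)
    next
      case False
      then have r: "r n \<in> E n" unfolding r_def by (simp add: some_in_eq)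
      have "(\<Sum>e\<in>E n. c e) = (\<Sum>e\<in>E n. if e = r n then fps_nth f n else 0)"
        by (rule sum.cong) (auto simp: c_def E_def)
      then show ?thesis using r fin by simp
    qed
    then show "\<exists>c :: nat list \<Rightarrow> 'a. \<forall>n. fps_nth f n = (\<Sum>e\<in>E n. c e)" by blast
  qed
  then show ?thesis
    by (simp add: power_series_subring_def series_ring_def E_def)
qed

section \<open>Ideals described by their exponents\<close>

lemma ideal_power_0: "ideal_power R J 0 = carrier R"
  by (simp add: nat_pow_def ideals_set_def)

lemma ideal_power_Suc: "ideal_power R J (Suc n) = ideal_power R J n \<cdot>\<^bsub>R\<^esub> J"
  by (simp add: nat_pow_def ideals_set_def)

locale additive_submonoid =
  fixes S :: "nat set"
  assumes zero_mem: "0 \<in> S"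
    and add_mem: "a \<in> S \<Longrightarrow> b \<in> S \<Longrightarrow> a + b \<in> S"
begin

lemma cring_series_ring: "cring (series_ring S :: 'a::comm_ring_1 fps ring)"
proof (rule cringI)
  show "abelian_group (series_ring S :: 'a fps ring)"
  proof (rule abelian_groupI)
    fix x :: "'a fps" assume "x \<in> carrier (series_ring S)"
    then show "\<exists>y\<in>carrier (series_ring S). y \<oplus>\<^bsub>series_ring S\<^esub> x = \<zero>\<^bsub>series_ring S\<^esub>"
      by (intro bexI[of _ "- x"]) (auto intro: supported_uminus)
  qed (auto simp: supported_add algebra_simps)
  have "(1 :: 'a fps) \<in> supported S"
    using fps_X_power_supported[OF zero_mem] by simp
  then show "comm_monoid (series_ring S :: 'a fps ring)"
    by (intro comm_monoidI) (auto simp: algebra_simps intro: supported_mult add_mem)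
qed (auto simp: algebra_simps)

lemma ideal_supported:
  assumes "T \<subseteq> S" "\<And>s t. s \<in> S \<Longrightarrow> t \<in> T \<Longrightarrow> s + t \<in> T"
  shows "ideal (supported T) (series_ring S :: 'a::comm_ring_1 fps ring)"
proof -
  interpret cring "series_ring S :: 'a fps ring" by (rule cring_series_ring)
  show ?thesis
  proof (rule idealI)
    \<comment> \<open>The ring inverse is defined only through the record, so it is first identified
      with negation of series.\<close>
    have inv: "\<ominus>\<^bsub>series_ring S\<^esub> x = - x" if "x \<in> supported S" for x :: "'a fps"
      using that minus_equality[of "- x" x] by (simp add: supported_uminus)
    show "subgroup (supported T) (add_monoid (series_ring S :: 'a fps ring))"
    proof (rule add.subgroupI)
      show "supported T \<subseteq> carrier (series_ring S :: 'a fps ring)"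
        using supported_mono[OF assms(1)] by simp
      then show "\<ominus>\<^bsub>series_ring S\<^esub> x \<in> supported T" if "x \<in> supported T" for x :: "'a fps"
        using that by (subst inv) (auto intro: supported_uminus)
      show "supported T \<noteq> ({} :: 'a fps set)" using supported_zero by blast
    qed (auto intro: supported_add)
    fix f g :: "'a fps" assume "f \<in> supported T" "g \<in> carrier (series_ring S)"
    then show "g \<otimes>\<^bsub>series_ring S\<^esub> f \<in> supported T"
      by (auto intro!: supported_mult assms(2))
    then show "f \<otimes>\<^bsub>series_ring S\<^esub> g \<in> supported T"
      by (simp add: mult.commute)
  qed (rule ring_axioms)
qed

text \<open>
  The finite set \<open>E\<close> makes every element of \<open>supported T\<close> a finite sum of products: each exponent
  in \<open>T\<close> is assigned to one element of \<open>E\<close>, and \<open>f\<close> is split accordingly.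
\<close>

lemma ideal_prod_supported:
  assumes add: "\<And>a b. a \<in> T1 \<Longrightarrow> b \<in> T2 \<Longrightarrow> a + b \<in> T"
    and E: "finite E" "E \<subseteq> T2"
    and split: "\<And>t. t \<in> T \<Longrightarrow> \<exists>e\<in>E. \<exists>a\<in>T1. t = a + e"
  shows "supported T1 \<cdot>\<^bsub>series_ring S\<^esub> supported T2 = (supported T :: 'a::comm_ring_1 fps set)"
proof
  let ?R = "series_ring S :: 'a fps ring"
  show "supported T1 \<cdot>\<^bsub>?R\<^esub> supported T2 \<subseteq> (supported T :: 'a fps set)"
  proof
    fix f :: "'a fps" assume "f \<in> supported T1 \<cdot>\<^bsub>?R\<^esub> supported T2"
    then show "f \<in> supported T"
      by induction (auto intro: supported_mult add supported_add)
  qed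
  show "(supported T :: 'a fps set) \<subseteq> supported T1 \<cdot>\<^bsub>?R\<^esub> supported T2"
  proof
    fix f :: "'a fps" assume f: "f \<in> supported T"
    from split obtain ch where ch: "\<And>t. t \<in> T \<Longrightarrow> ch t \<in> E \<and> (\<exists>a\<in>T1. t = a + ch t)"
      by metis
    \<comment> \<open>The part of \<open>f\<close> assigned to \<open>e\<close>, shifted down by
      \<open>e\<close>. If \<open>ch (n + e) = e\<close>, then \<open>n + e = a + e\<close> with
      \<open>a\<close> in \<open>T1\<close>, so the shifted exponent \<open>n\<close> lies in
      \<open>T1\<close>.\<close>
    define g where "g e = Abs_fps (\<lambda>n. if n + e \<in> T \<and> ch (n + e) = e then fps_nth f (n + e) else 0)" for e
    have g: "g e \<in> supported T1" for e
      unfolding g_def supported_def using ch by fastforce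
    have nth: "fps_nth (g e * fps_X ^ e) n = (if n \<in> T \<and> ch n = e then fps_nth f n else 0)" for e n
      unfolding g_def using ch[of n] by (auto simp: fps_X_power_mult_right_nth)
    have "f = (\<Sum>e\<in>E. g e * fps_X ^ e)"
    proof (rule fps_ext)
      fix n
      show "fps_nth f n = fps_nth (\<Sum>e\<in>E. g e * fps_X ^ e) n"
        using ch[of n] f E(1) unfolding fps_sum_nth nth
        by (cases "n \<in> T") (auto simp: supported_def)
    qed
    \<comment> \<open>The ideal product is generated inductively by products and binary sums, hence
      the induction over subsets of \<open>E\<close>.\<close>
    moreover have "(\<Sum>e\<in>E'. g e * fps_X ^ e) \<in> supported T1 \<cdot>\<^bsub>?R\<^esub> supported T2" if "E' \<subseteq> E" "finite E'" for E'
      using that(2,1)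
    proof induction
      case empty
      show ?case using ideal_prod.prod[of 0 "supported T1" 0 "supported T2" ?R] by simp
    next
      case (insert e E')
      then have "g e * fps_X ^ e \<in> supported T1 \<cdot>\<^bsub>?R\<^esub> supported T2"
        using ideal_prod.prod[of "g e" "supported T1" "fps_X ^ e" "supported T2" ?R] g E
        by (auto simp: fps_X_power_supported)
      then show ?case
        using insert ideal_prod.sum[of "g e * fps_X ^ e" ?R "supported T1" "supported T2"] by auto
    qed
    ultimately show "f \<in> supported T1 \<cdot>\<^bsub>?R\<^esub> supported T2" using E(1) by simp
  qed
qed

text \<open>The right factor is the principal ideal of the monomial with exponent \<open>m\<close>,
  so \<open>{m}\<close> serves as the finite set \<open>E\<close>. This yields both the powers of
  \<open>I\<close> and the products of the maximal ideal with them.\<close>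

lemma supported_ideal_prod_translate:
  assumes "m \<in> S" "\<And>s t. s \<in> S \<Longrightarrow> t \<in> T \<Longrightarrow> s + t \<in> T"
  shows "supported T \<cdot>\<^bsub>series_ring S\<^esub> supported ((+) m ` S) = (supported ((+) m ` T) :: 'a::comm_ring_1 fps set)"
proof (rule ideal_prod_supported[where E = "{m}"])
  fix a b assume a: "a \<in> T" and "b \<in> (+) m ` S"
  then obtain s where s: "s \<in> S" "b = m + s" by auto
  then show "a + b \<in> (+) m ` T"
    using assms(2)[OF s(1) a] by (intro image_eqI[of _ _ "s + a"]) auto
next
  show "{m} \<subseteq> (+) m ` S" using zero_mem by (auto intro: image_eqI[of _ _ 0])
qed (auto simp: add.commute)

lemma translate_ideal_power:
  assumes m: "m \<in> S"
  shows "ideal_power (series_ring S) (supported ((+) m ` S)) n =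
    (supported ((+) (n * m) ` S) :: 'a::comm_ring_1 fps set)"
proof (induction n)
  case 0
  have "(+) (0 :: nat) = id" by auto
  then show ?case by (subst ideal_power_0) simp
next
  case (Suc n)
  have nm: "n * m \<in> S" by (induction n) (auto intro: add_mem zero_mem m)
  have "s + t \<in> (+) (n * m) ` S" if "s \<in> S" "t \<in> (+) (n * m) ` S" for s t
    using that add_mem by (force simp: add_ac intro: image_eqI[of _ _ "s + (t - n * m)"])
  then have "supported ((+) (n * m) ` S) \<cdot>\<^bsub>series_ring S\<^esub> supported ((+) m ` S) =
      (supported ((+) m ` (+) (n * m) ` S) :: 'a fps set)"
    by (rule supported_ideal_prod_translate[OF m])
  then show ?case by (subst ideal_power_Suc) (simp add: Suc image_image add.assoc)
qed

section \<open>The maximal ideal and monomial principal ideals\<close>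

text \<open>Coefficient \<open>n\<close> of the inverse is determined by the products of coefficient
  \<open>i\<close> of \<open>f\<close> and coefficient \<open>n - i\<close> of the inverse,
  \<open>i \<ge> 1\<close>. If \<open>n\<close> is outside \<open>S\<close>, then \<open>i\<close>
  and \<open>n - i\<close> are not both in \<open>S\<close>, so by induction all these products
  vanish.\<close>

lemma inverse_supported:
  fixes f :: "'a::field fps"
  assumes f: "f \<in> supported S" and "fps_nth f 0 \<noteq> 0"
  shows "inverse f \<in> supported S"
proof (rule supportedI)
  fix n show "n \<notin> S \<Longrightarrow> fps_nth (inverse f) n = 0"
  proof (induction n rule: less_induct)
    case (less n)
    have n: "n > 0" using less.prems zero_mem by (cases n) auto
    have z: "fps_nth f i * fps_nth (inverse f) (n - i) = 0" if "i \<in> {1..n}" for i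
    proof (cases "i \<in> S")
      case True
      then have "n - i \<notin> S" using add_mem[of i "n - i"] that less.prems by auto
      then show ?thesis using less.IH[of "n - i"] that by simp
    next
      case False
      then show ?thesis using f by (simp add: supported_def)
    qed
    have "f * inverse f = 1" using assms(2) by (simp add: inverse_mult_eq_1')
    then have "0 = fps_nth (f * inverse f) n" using n by simp
    also have "\<dots> = fps_nth f 0 * fps_nth (inverse f) n +
        (\<Sum>i\<in>{1..n}. fps_nth f i * fps_nth (inverse f) (n - i))"
      by (simp add: fps_mult_nth sum.atLeast_Suc_atMost)
    also have "(\<Sum>i\<in>{1..n}. fps_nth f i * fps_nth (inverse f) (n - i)) = 0"
      by (rule sum.neutral) (use z in blast)
    finally show ?case using assms(2) by simp
  qed
qed

text \<open>The ring is local: a series with nonzero constant term is invertible inside the ring by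
  \<open>inverse_supported\<close>, so every proper ideal lies in
  \<open>supported (S - {0})\<close>, which is itself a proper ideal.\<close>

lemma maximal_ideal_eq:
  assumes max: "maximalideal M (series_ring S :: 'a::field fps ring)"
  shows "M = supported (S - {0})"
proof -
  let ?R = "series_ring S :: 'a fps ring"
  interpret maximalideal M ?R by (rule max)
  have "M \<subseteq> supported (S - {0})"
  proof (rule ccontr)
    assume "\<not> M \<subseteq> supported (S - {0})"
    then obtain f where f: "f \<in> M" "f \<notin> supported (S - {0})" by blast
    have fS: "f \<in> supported S" using f(1) Icarr by simp
    with f(2) have f0: "fps_nth f 0 \<noteq> 0" by (auto simp: supported_def)
    have "inverse f * f \<in> M"
      using I_l_closed[of f "inverse f"] f(1) inverse_supported[OF fS f0] by simp
    then have "1 \<in> M" using f0 by (simp add: inverse_mult_eq_1)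
    then show False using one_imp_carrier I_notcarr by simp
  qed
  moreover have "ideal (supported (S - {0})) ?R"
    by (rule ideal_supported) (auto intro: add_mem)
  moreover have "(1 :: 'a fps) \<in> supported S" "(1 :: 'a fps) \<notin> supported (S - {0})"
    using zero_mem by (auto simp: supported_def)
  ultimately show ?thesis
    using I_maximal[of "supported (S - {0})"] supported_mono[of "S - {0}" S] by auto
qed

lemma genideal_fps_X_power:
  assumes "m \<in> S"
  shows "Idl\<^bsub>series_ring S\<^esub> {fps_X ^ m} = (supported ((+) m ` S) :: 'a::comm_ring_1 fps set)"
proof -
  interpret cring "series_ring S :: 'a fps ring" by (rule cring_series_ring)
  have X: "(fps_X ^ m :: 'a fps) \<in> supported S" using assms by (rule fps_X_power_supported)
  have "PIdl\<^bsub>series_ring S\<^esub> (fps_X ^ m) = (supported ((+) m ` S) :: 'a fps set)"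
  proof (intro equalityI subsetI)
    fix f :: "'a fps" assume "f \<in> PIdl\<^bsub>series_ring S\<^esub> (fps_X ^ m)"
    then show "f \<in> supported ((+) m ` S)"
      unfolding cgenideal_def
      by (auto intro!: supported_mult[where A = S and B = "{m}"] fps_X_power_supported)
  next
    fix f :: "'a fps" assume f: "f \<in> supported ((+) m ` S)"
    \<comment> \<open>The cofactor is the shift by \<open>m\<close>; nothing is lost because
      \<open>f\<close> has no exponents below \<open>m\<close>.\<close>
    have "f = fps_shift m f * fps_X ^ m"
    proof (rule fps_ext)
      fix n show "fps_nth f n = fps_nth (fps_shift m f * fps_X ^ m) n"
        using supportedD[OF f, of n] by (auto simp: fps_X_power_mult_right_nth)
    qed
    moreover have "fps_shift m f \<in> supported S"
      using f by (rule supported_shift) auto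
    ultimately show "f \<in> PIdl\<^bsub>series_ring S\<^esub> (fps_X ^ m)"
      unfolding cgenideal_def by auto
  qed
  then show ?thesis using cgenideal_eq_genideal[of "fps_X ^ m"] X by simp
qed

end

section \<open>Modules with polynomial coordinates\<close>

text \<open>No ring law is assumed for \<open>F\<close>; all of them are transported from
  \<open>'p\<close> along the bijection. It is applied with \<open>'p\<close> a polynomial ring and
  \<open>F\<close> the fiber cone.\<close>

locale scalar_iso =
  fixes F :: "('a, 'c) ring_scheme" and \<phi> :: "'p::comm_ring_1 \<Rightarrow> 'a"
  assumes bij_scalar: "bij_betw \<phi> UNIV (carrier F)"
    and scalar_add: "\<phi> p \<oplus>\<^bsub>F\<^esub> \<phi> q = \<phi> (p + q)"
    and scalar_mult: "\<phi> p \<otimes>\<^bsub>F\<^esub> \<phi> q = \<phi> (p * q)"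
    and scalar_zero: "\<zero>\<^bsub>F\<^esub> = \<phi> 0"
    and scalar_one: "\<one>\<^bsub>F\<^esub> = \<phi> 1"
begin

lemma scalar_carrier: "carrier F = range \<phi>"
  using bij_scalar by (simp add: bij_betw_def)

lemma cring_scalars: "cring F"
proof (rule cringI)
  show "abelian_group F"
  proof (rule abelian_groupI)
    fix x assume "x \<in> carrier F"
    then obtain p where "x = \<phi> p" by (auto simp: scalar_carrier)
    then show "\<exists>y\<in>carrier F. y \<oplus>\<^bsub>F\<^esub> x = \<zero>\<^bsub>F\<^esub>"
      by (intro bexI[of _ "\<phi> (- p)"]) (auto simp: scalar_carrier scalar_add scalar_zero)
  qed (auto simp: scalar_carrier scalar_add scalar_zero algebra_simps)
  show "comm_monoid F"
    by (rule comm_monoidI) (auto simp: scalar_carrier scalar_mult scalar_one algebra_simps)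
qed (auto simp: scalar_carrier scalar_add scalar_mult algebra_simps)

end

text \<open>
  \<open>\<psi>\<close> identifies the free \<open>K[T]\<close>-module with basis \<open>J\<close>, the basis element \<open>j\<close> having degree \<open>d j\<close>,
  with \<open>M\<close>; the values of coordinate functions outside \<open>J\<close> are irrelevant.
\<close>

locale graded_coordinates =
  fixes \<phi> :: "'k::comm_ring_1 poly \<Rightarrow> 'a" and M :: "('a, 'b) graded_module"
    and J :: "'j set" and d :: "'j \<Rightarrow> nat" and \<psi> :: "('j \<Rightarrow> 'k poly) \<Rightarrow> 'b"
  assumes carrier_eq: "carrier M = range \<psi>"
    and eq_iff: "\<psi> y = \<psi> z \<longleftrightarrow> (\<forall>j\<in>J. y j = z j)"
    and add: "\<psi> y \<oplus>\<^bsub>M\<^esub> \<psi> z = \<psi> (\<lambda>j. y j + z j)"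
    and smult: "\<phi> p \<odot>\<^bsub>M\<^esub> \<psi> y = \<psi> (\<lambda>j. p * y j)"
    and zero: "\<zero>\<^bsub>M\<^esub> = \<psi> (\<lambda>_. 0)"
    and component_eq:
      "component M n = \<psi> ` {y. \<forall>j\<in>J. \<forall>i. coeff (y j) i \<noteq> 0 \<longrightarrow> i + d j = n}"
begin

text \<open>The basis consists of the coordinate vectors \<open>e j\<close>: a linear combination of
  them has its scalars as coordinates, which gives generation and independence at once.\<close>

lemma free_module_coordinates:
  assumes F: "scalar_iso F \<phi>" and fin: "finite J"
  shows "free_module F M"
proof -
  interpret scalar_iso F \<phi> by (rule F)
  interpret F: cring F by (rule cring_scalars)
  have M: "module F M"
  proof (rule moduleI[OF cring_scalars])
    show "abelian_group M"
    proof (rule abelian_groupI)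
      fix x assume "x \<in> carrier M"
      then obtain y where "x = \<psi> y" by (auto simp: carrier_eq)
      then show "\<exists>x'\<in>carrier M. x' \<oplus>\<^bsub>M\<^esub> x = \<zero>\<^bsub>M\<^esub>"
        by (intro bexI[of _ "\<psi> (\<lambda>j. - y j)"]) (auto simp: carrier_eq add zero)
    qed (auto simp: carrier_eq add zero algebra_simps)
  qed (auto simp: carrier_eq scalar_carrier scalar_add scalar_mult scalar_one add smult algebra_simps)
  interpret module F M by (rule M)
  define e where "e j = \<psi> (\<lambda>i. if i = j then 1 else 0)" for j
  \<comment> \<open>Freeness is stated for a set of vectors, so distinct indices must give distinct
    vectors; this rests on 1 and 0 being different polynomials.\<close>
  have inj: "inj_on e J"
  proof (rule inj_onI)
    fix i j assume "i \<in> J" "e i = e j"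
    then show "i = j" by (auto simp: e_def eq_iff split: if_splits dest!: bspec[of _ _ i])
  qed
  have eJ: "e ` J \<subseteq> carrier M" by (auto simp: e_def carrier_eq)
  have lincomb: "(\<Oplus>\<^bsub>M\<^esub>j\<in>A. \<phi> (p j) \<odot>\<^bsub>M\<^esub> e j) = \<psi> (\<lambda>i. if i \<in> A then p i else 0)"
    if "finite A" for A p
    using that
  proof induction
    case empty
    show ?case by (simp add: zero)
  next
    case (insert j A)
    have "(\<Oplus>\<^bsub>M\<^esub>j\<in>insert j A. \<phi> (p j) \<odot>\<^bsub>M\<^esub> e j) =
        \<psi> (\<lambda>i. p j * (if i = j then 1 else 0) + (if i \<in> A then p i else 0))"
      using insert by (simp add: e_def smult add carrier_eq Pi_def)
    also have "(\<lambda>i. p j * (if i = j then 1 else 0) + (if i \<in> A then p i else 0)) =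
        (\<lambda>i. if i \<in> insert j A then p i else 0)"
      using insert by auto
    finally show ?case .
  qed
  have lincomb_basis: "lincomb a (e ` J) = \<psi> (\<lambda>i. if i \<in> J then p i else 0)"
    if "\<And>j. j \<in> J \<Longrightarrow> a (e j) = \<phi> (p j)" for a p
  proof -
    have a: "a \<in> e ` J \<rightarrow> carrier F" using that by (auto simp: scalar_carrier)
    have "lincomb a (e ` J) = (\<Oplus>\<^bsub>M\<^esub>j\<in>J. a (e j) \<odot>\<^bsub>M\<^esub> e j)"
      unfolding lincomb_def using a eJ by (intro M.add.finprod_reindex inj) auto
    also have "\<dots> = (\<Oplus>\<^bsub>M\<^esub>j\<in>J. \<phi> (p j) \<odot>\<^bsub>M\<^esub> e j)"
      by (rule M.add.finprod_cong') (use eJ in \<open>auto simp: that scalar_carrier\<close>)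
    finally show ?thesis using lincomb[OF fin] by simp
  qed
  have "gen_set (e ` J)"
  proof
    show "span (e ` J) \<subseteq> carrier M" using eJ by (auto simp: span_def)
    show "carrier M \<subseteq> span (e ` J)"
    proof
      fix x assume "x \<in> carrier M"
      then obtain y where y: "x = \<psi> y" by (auto simp: carrier_eq)
      define a where "a v = \<phi> (y (inv_into J e v))" for v
      have "lincomb a (e ` J) = \<psi> (\<lambda>i. if i \<in> J then y i else 0)"
        by (rule lincomb_basis) (simp add: a_def inj)
      also have "\<dots> = x" by (simp add: y eq_iff)
      finally have "x = lincomb a (e ` J)" ..
      then show "x \<in> span (e ` J)"
        unfolding span_def using fin
        by (intro CollectI exI[of _ a] exI[of _ "e ` J"]) (auto simp: a_def scalar_carrier)
    qed
  qed
  moreover have "lin_indpt (e ` J)"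
  proof (rule finite_lin_indpt2[OF _ eJ])
    fix a assume a: "a \<in> e ` J \<rightarrow> carrier F" and 0: "lincomb a (e ` J) = \<zero>\<^bsub>M\<^esub>"
    have "\<forall>j\<in>J. \<exists>p. a (e j) = \<phi> p" using a by (auto simp: scalar_carrier Pi_def)
    then obtain p where p: "\<And>j. j \<in> J \<Longrightarrow> a (e j) = \<phi> (p j)" by metis
    have "\<psi> (\<lambda>i. if i \<in> J then p i else 0) = \<psi> (\<lambda>_. 0)"
      using lincomb_basis[of a p] p 0 by (simp add: zero)
    then show "\<forall>v\<in>e ` J. a v = \<zero>\<^bsub>F\<^esub>" by (auto simp: eq_iff p scalar_zero)
  qed (use fin in simp)
  ultimately show ?thesis unfolding free_module_def using M eJ by blast
qed

lemma graded_coordinates_shift: "graded_coordinates \<phi> (graded_shift M k) J (\<lambda>j. d j + k) \<psi>"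
proof
  show "component (graded_shift M k) n =
      \<psi> ` {y. \<forall>j\<in>J. \<forall>i. coeff (y j) i \<noteq> 0 \<longrightarrow> i + (d j + k) = n}" for n
  proof (cases "k \<le> n")
    case True
    then have "i + (d j + k) = n \<longleftrightarrow> i + d j = n - k" for i j by auto
    then show ?thesis using True by (simp add: graded_shift_def component_eq)
  next
    case False
    \<comment> \<open>Below degree \<open>k\<close> no monomial satisfies the degree condition, so
      only the zero vector remains, as in the default case of \<open>graded_shift\<close>.\<close>
    let ?H = "{y. \<forall>j\<in>J. \<forall>i. coeff (y j) i \<noteq> 0 \<longrightarrow> i + (d j + k) = n}"
    have "\<psi> y = \<psi> (\<lambda>_. 0)" if y: "y \<in> ?H" for y
    proof -
      have "coeff (y j) i = 0" if "j \<in> J" for i j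
      proof (rule ccontr)
        assume "coeff (y j) i \<noteq> 0"
        then have "i + (d j + k) = n" using y that by blast
        then show False using False by linarith
      qed
      then show ?thesis by (simp add: eq_iff poly_eq_iff)
    qed
    moreover have "(\<lambda>_. 0) \<in> ?H" by simp
    ultimately have "\<psi> ` ?H = {\<psi> (\<lambda>_. 0)}" by blast
    then show ?thesis using False by (simp add: graded_shift_def zero)
  qed
qed (simp_all add: graded_shift_def carrier_eq eq_iff add smult zero)

end

section \<open>Coordinates on direct sums, and isomorphism by matching degrees\<close>

text \<open>The bases of the summands are put side by side, indexed by \<open>Sigma I J\<close>. As
  \<open>I\<close> is finite, the finite support condition in \<open>graded_Sum\<close> holds
  automatically.\<close>

lemma graded_coordinates_Sum:
  assumes I: "finite I" and N: "\<And>k. k \<in> I \<Longrightarrow> graded_coordinates \<phi> (N k) (J k) (d k) (\<psi> k)"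
  shows "graded_coordinates \<phi> (graded_Sum I N) (Sigma I J) (\<lambda>(k, j). d k j)
    (\<lambda>y. \<lambda>k\<in>I. \<psi> k (\<lambda>j. y (k, j)))"
proof -
  let ?\<Psi> = "\<lambda>y. \<lambda>k\<in>I. \<psi> k (\<lambda>j. y (k, j))"
  note coords = graded_coordinates.carrier_eq[OF N] graded_coordinates.eq_iff[OF N]
    graded_coordinates.add[OF N] graded_coordinates.smult[OF N] graded_coordinates.zero[OF N]
  have carr: "carrier (graded_Sum I N) = (\<Pi>\<^sub>E k\<in>I. carrier (N k))"
    using I by (simp add: graded_Sum_def Let_def)
  \<comment> \<open>Coordinates chosen in each summand are glued. The predicate \<open>P\<close>
    lets one choice argument serve the carrier (trivial \<open>P\<close>) and the homogeneous
    components.\<close>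
  have surj: "\<exists>y. x = ?\<Psi> y \<and> (\<forall>k\<in>I. P k (\<lambda>j. y (k, j)))"
    if ext: "x \<in> extensional I" and ex: "\<And>k. k \<in> I \<Longrightarrow> \<exists>y. x k = \<psi> k y \<and> P k y" for x P
  proof -
    obtain y where y: "\<And>k. k \<in> I \<Longrightarrow> x k = \<psi> k (y k) \<and> P k (y k)" using ex by metis
    have "x = ?\<Psi> (\<lambda>(k, j). y k j)" using ext y by (auto simp: extensional_def fun_eq_iff)
    then show ?thesis using y by (intro exI[of _ "\<lambda>(k, j). y k j"]) simp
  qed
  show ?thesis
  proof
    show carr_eq: "carrier (graded_Sum I N) = range ?\<Psi>"
    proof
      show "carrier (graded_Sum I N) \<subseteq> range ?\<Psi>"
      proof
        fix x assume x: "x \<in> carrier (graded_Sum I N)"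
        then have "\<exists>y. x = ?\<Psi> y \<and> (\<forall>k\<in>I. True)"
          by (intro surj) (auto simp: carr PiE_def Pi_def coords)
        then show "x \<in> range ?\<Psi>" by blast
      qed
    qed (auto simp: carr coords intro!: rangeI)
    show "?\<Psi> y = ?\<Psi> z \<longleftrightarrow> (\<forall>j\<in>Sigma I J. y j = z j)" for y z
    proof -
      have "?\<Psi> y = ?\<Psi> z \<longleftrightarrow> (\<forall>k\<in>I. \<psi> k (\<lambda>j. y (k, j)) = \<psi> k (\<lambda>j. z (k, j)))"
        by (auto simp: fun_eq_iff restrict_def)
      then show ?thesis by (auto simp: coords)
    qed
    show "?\<Psi> y \<oplus>\<^bsub>graded_Sum I N\<^esub> ?\<Psi> z = ?\<Psi> (\<lambda>j. y j + z j)" for y z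
      by (auto simp: graded_Sum_def Let_def coords intro!: restrict_ext)
    show "\<phi> p \<odot>\<^bsub>graded_Sum I N\<^esub> ?\<Psi> y = ?\<Psi> (\<lambda>j. p * y j)" for p y
      by (auto simp: graded_Sum_def Let_def coords intro!: restrict_ext)
    show "\<zero>\<^bsub>graded_Sum I N\<^esub> = ?\<Psi> (\<lambda>_. 0)"
      by (auto simp: graded_Sum_def Let_def coords intro!: restrict_ext)
    fix n
    let ?hom = "\<lambda>k y. \<forall>j\<in>J k. \<forall>i. coeff (y j) i \<noteq> 0 \<longrightarrow> i + d k j = n"
    have comp: "component (graded_Sum I N) n =
        {x \<in> carrier (graded_Sum I N). \<forall>k\<in>I. x k \<in> component (N k) n}"
      by (simp add: graded_Sum_def Let_def)
    note comp_N = graded_coordinates.component_eq[OF N]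
    show "component (graded_Sum I N) n =
      ?\<Psi> ` {y. \<forall>j\<in>Sigma I J. \<forall>i. coeff (y j) i \<noteq> 0 \<longrightarrow> i + (case j of (k, j) \<Rightarrow> d k j) = n}"
    proof
      show "component (graded_Sum I N) n \<subseteq>
        ?\<Psi> ` {y. \<forall>j\<in>Sigma I J. \<forall>i. coeff (y j) i \<noteq> 0 \<longrightarrow> i + (case j of (k, j) \<Rightarrow> d k j) = n}"
      proof
        fix x assume x: "x \<in> component (graded_Sum I N) n"
        have "\<exists>y. x = ?\<Psi> y \<and> (\<forall>k\<in>I. ?hom k (\<lambda>j. y (k, j)))"
        proof (rule surj)
          show "x \<in> extensional I" using x by (auto simp: comp carr PiE_def)
          fix k assume "k \<in> I"
          then have "x k \<in> component (N k) n" using x by (simp add: comp)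
          then show "\<exists>y. x k = \<psi> k y \<and> ?hom k y" using comp_N[OF \<open>k \<in> I\<close>] by auto
        qed
        then show "x \<in> ?\<Psi> ` {y. \<forall>j\<in>Sigma I J. \<forall>i. coeff (y j) i \<noteq> 0 \<longrightarrow> i + (case j of (k, j) \<Rightarrow> d k j) = n}"
          by force
      qed
    qed (unfold comp carr_eq, auto simp: comp_N)
  qed
qed

lemma graded_coordinates_sum:
  assumes "graded_coordinates \<phi> M J d \<psi>" "graded_coordinates \<phi> N J' d' \<psi>'"
  shows "graded_coordinates \<phi> (graded_sum M N) (Sum_Type.Plus J J') (case_sum d d')
    (\<lambda>y. (\<psi> (y \<circ> Inl), \<psi>' (y \<circ> Inr)))"
proof -
  interpret M: graded_coordinates \<phi> M J d \<psi> by fact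
  interpret N: graded_coordinates \<phi> N J' d' \<psi>' by fact
  let ?\<Psi> = "\<lambda>y. (\<psi> (y \<circ> Inl), \<psi>' (y \<circ> Inr))"
  have sums [simp]:
    "carrier (graded_sum M N) = carrier M \<times> carrier N"
    "x \<oplus>\<^bsub>graded_sum M N\<^esub> y = (fst x \<oplus>\<^bsub>M\<^esub> fst y, snd x \<oplus>\<^bsub>N\<^esub> snd y)"
    "c \<odot>\<^bsub>graded_sum M N\<^esub> x = (c \<odot>\<^bsub>M\<^esub> fst x, c \<odot>\<^bsub>N\<^esub> snd x)"
    "\<zero>\<^bsub>graded_sum M N\<^esub> = (\<zero>\<^bsub>M\<^esub>, \<zero>\<^bsub>N\<^esub>)"
    "component (graded_sum M N) n = component M n \<times> component N n" for x y c n
    by (simp_all add: graded_sum_def module.extend_def graded_module.fields_def direct_sum_def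
        split: prod.split)
  have pair: "(\<psi> y, \<psi>' z) = ?\<Psi> (case_sum y z)" for y z
    by (simp add: comp_def)
  show ?thesis
  proof
    show "carrier (graded_sum M N) = range ?\<Psi>"
      using pair by (auto simp: M.carrier_eq N.carrier_eq)
    show "?\<Psi> y = ?\<Psi> z \<longleftrightarrow> (\<forall>j\<in>Sum_Type.Plus J J'. y j = z j)" for y z
      by (auto simp: M.eq_iff N.eq_iff)
    fix n
    let ?H = "{y. \<forall>j\<in>Sum_Type.Plus J J'. \<forall>i. coeff (y j) i \<noteq> 0 \<longrightarrow> i + case_sum d d' j = n}"
    show "component (graded_sum M N) n = ?\<Psi> ` ?H"
    proof
      show "component (graded_sum M N) n \<subseteq> ?\<Psi> ` ?H"
      proof
        fix x assume "x \<in> component (graded_sum M N) n"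
        then obtain y z where "x = (\<psi> y, \<psi>' z)" and
          "\<forall>j\<in>J. \<forall>i. coeff (y j) i \<noteq> 0 \<longrightarrow> i + d j = n"
          "\<forall>j\<in>J'. \<forall>i. coeff (z j) i \<noteq> 0 \<longrightarrow> i + d' j = n"
          by (auto simp: M.component_eq N.component_eq)
        then have "x = ?\<Psi> (case_sum y z)" "case_sum y z \<in> ?H" by (auto simp: comp_def)
        then show "x \<in> ?\<Psi> ` ?H" by (rule image_eqI)
      qed
      show "?\<Psi> ` ?H \<subseteq> component (graded_sum M N) n"
      proof
        fix x assume "x \<in> ?\<Psi> ` ?H"
        then obtain y where y: "y \<in> ?H" and x: "x = ?\<Psi> y" by blast
        have "\<psi> (y \<circ> Inl) \<in> component M n"
          unfolding M.component_eq using y by (intro imageI) force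
        moreover have "\<psi>' (y \<circ> Inr) \<in> component N n"
          unfolding N.component_eq using y by (intro imageI) force
        ultimately show "x \<in> component (graded_sum M N) n" by (simp add: x)
      qed
    qed
  qed (auto simp: M.add N.add M.smult N.smult M.zero N.zero comp_def)
qed

text \<open>Graded free modules whose bases match degree by degree are isomorphic. The bijection
  runs from \<open>J'\<close> to \<open>J\<close> because coordinates are pulled back by
  composition.\<close>

lemma graded_isomorphic_coordinates:
  assumes M: "graded_coordinates \<phi> M J d \<psi>" and N: "graded_coordinates \<phi> N J' d' \<psi>'"
    and F: "carrier F = range \<phi>"
    and \<gamma>: "bij_betw \<gamma> J' J" "\<And>j. j \<in> J' \<Longrightarrow> d (\<gamma> j) = d' j"
  shows "graded_isomorphic F M N"
proof -
  interpret M: graded_coordinates \<phi> M J d \<psi> by fact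
  interpret N: graded_coordinates \<phi> N J' d' \<psi>' by fact
  \<comment> \<open>The chosen coordinates are determined only on \<open>J\<close>; since
    \<open>\<gamma>\<close> maps \<open>J'\<close> into \<open>J\<close>, the value of
    \<open>f\<close> does not depend on the choice.\<close>
  define f where "f x = \<psi>' ((SOME y. x = \<psi> y) \<circ> \<gamma>)" for x
  have J: "J = \<gamma> ` J'" and inj: "inj_on \<gamma> J'" using \<gamma>(1) by (auto simp: bij_betw_def)
  have f: "f (\<psi> y) = \<psi>' (y \<circ> \<gamma>)" for y
  proof -
    have "\<psi> y = \<psi> (SOME z. \<psi> y = \<psi> z)" by (rule someI[of "\<lambda>z. \<psi> y = \<psi> z", OF refl])
    then show ?thesis unfolding f_def M.eq_iff N.eq_iff by (auto simp: J)
  qed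
  have hom: "f \<in> module_hom F M N"
    unfolding module_hom_def
    by (auto simp: M.carrier_eq N.carrier_eq F M.add N.add M.smult N.smult f comp_def)
  have inv: "\<psi>' y = f (\<psi> (y \<circ> inv_into J' \<gamma>))" for y
    unfolding f N.eq_iff using inj by simp
  have "bij_betw f (carrier M) (carrier N)"
    unfolding bij_betw_def
  proof
    show "inj_on f (carrier M)"
      by (auto simp: inj_on_def M.carrier_eq f N.eq_iff M.eq_iff J)
    show "f ` carrier M = carrier N"
    proof
      show "f ` carrier M \<subseteq> carrier N" unfolding M.carrier_eq N.carrier_eq using f by blast
      show "carrier N \<subseteq> f ` carrier M" unfolding M.carrier_eq N.carrier_eq using inv by blast
    qed
  qed
  moreover have "f ` component M n = component N n" for n
  proof
    show "f ` component M n \<subseteq> component N n"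
    proof
      fix x assume "x \<in> f ` component M n"
      then obtain y where y: "\<forall>j\<in>J. \<forall>i. coeff (y j) i \<noteq> 0 \<longrightarrow> i + d j = n" "x = f (\<psi> y)"
        unfolding M.component_eq by blast
      have "\<forall>j\<in>J'. \<forall>i. coeff ((y \<circ> \<gamma>) j) i \<noteq> 0 \<longrightarrow> i + d' j = n"
        using y(1) \<gamma>(2) by (auto simp: J)
      then show "x \<in> component N n" unfolding y(2) f N.component_eq by blast
    qed
    show "component N n \<subseteq> f ` component M n"
    proof
      fix x assume "x \<in> component N n"
      then obtain y where y: "x = \<psi>' y" "\<forall>j\<in>J'. \<forall>i. coeff (y j) i \<noteq> 0 \<longrightarrow> i + d' j = n"
        by (auto simp: N.component_eq)
      then have "\<psi> (y \<circ> inv_into J' \<gamma>) \<in> component M n"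
        unfolding M.component_eq using \<gamma>(2) inj
        by (intro imageI CollectI ballI allI) (auto simp: J)
      then show "x \<in> f ` component M n" using inv y(1) by blast
    qed
  qed
  ultimately show ?thesis unfolding graded_isomorphic_def using hom by blast
qed

section \<open>Associated graded modules\<close>

text \<open>This is the coset \<open>f + supported Q\<close>, written so that equality of cosets
  becomes a comparison of coefficients outside \<open>Q\<close>.\<close>

definition fps_coset :: "nat set \<Rightarrow> 'a fps \<Rightarrow> 'a fps set" where
  "fps_coset Q f = {g. \<forall>n. n \<notin> Q \<longrightarrow> fps_nth g n = fps_nth f n}"

lemma fps_coset_eq_iff: "fps_coset Q f = fps_coset Q g \<longleftrightarrow> (\<forall>n. n \<notin> Q \<longrightarrow> fps_nth f n = fps_nth g n)"
  unfolding fps_coset_def set_eq_iff mem_Collect_eq by metis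

lemma fps_coset_zero: "fps_coset Q 0 = supported Q"
  by (simp add: fps_coset_def supported_def)

lemma a_r_coset_series_ring: "supported Q +>\<^bsub>series_ring S\<^esub> f = fps_coset Q f"
proof (intro equalityI subsetI)
  fix g assume g: "g \<in> fps_coset Q f"
  then have "g - f \<in> supported Q" by (simp add: fps_coset_def supported_def)
  then show "g \<in> supported Q +>\<^bsub>series_ring S\<^esub> f"
    unfolding a_r_coset_def' by (auto intro!: bexI[of _ "g - f"])
qed (auto simp: a_r_coset_def' fps_coset_def supported_def)

lemma set_add_fps_coset:
  "fps_coset Q f <+>\<^bsub>series_ring S\<^esub> fps_coset Q g = fps_coset Q (f + g)"
proof (intro equalityI subsetI)
  fix x assume x: "x \<in> fps_coset Q (f + g)"
  then have "x - g \<in> fps_coset Q f" "g \<in> fps_coset Q g"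
    by (auto simp: fps_coset_def algebra_simps)
  then show "x \<in> fps_coset Q f <+>\<^bsub>series_ring S\<^esub> fps_coset Q g"
    unfolding set_add_def' by (intro UN_I[of "x - g"] UN_I[of g]) auto
qed (auto simp: set_add_def' fps_coset_def)

text \<open>\<open>rcoset_mult\<close> is a union over all representatives, so independence of the
  choice is needed: \<open>a * b - f * g = (a - f) * b + f * (b - g)\<close>, and both terms are
  supported in \<open>Q\<close>. The two factors may come from different quotients, as in the action
  of the fiber cone on the tangent cone.\<close>

lemma rcoset_mult_fps_coset:
  fixes f g :: "'a::comm_ring_1 fps"
  assumes f: "f \<in> supported P1" and g: "g \<in> supported P2"
    and PQ: "\<And>a b. a \<in> P1 \<Longrightarrow> b \<in> Q2 \<Longrightarrow> a + b \<in> Q"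
    and QP: "\<And>a b. a \<in> Q1 \<Longrightarrow> b \<in> P2 \<Longrightarrow> a + b \<in> Q"
    and "Q2 \<subseteq> P2"
  shows "rcoset_mult (series_ring S) (supported Q) (fps_coset Q1 f) (fps_coset Q2 g) = fps_coset Q (f * g)"
proof -
  have eq: "fps_coset Q (a * b) = fps_coset Q (f * g)"
    if a: "a \<in> fps_coset Q1 f" and b: "b \<in> fps_coset Q2 g" for a b
  proof -
    have a': "a - f \<in> supported Q1" and b': "b - g \<in> supported Q2"
      using a b by (auto simp: fps_coset_def supported_def)
    have "b = (b - g) + g" by simp
    then have "b \<in> supported P2"
      using supported_add[OF _ g, of "b - g"] b' supported_mono[OF assms(5)] by auto
    then have "(a - f) * b \<in> supported Q" by (rule supported_mult[OF a' _ QP])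
    moreover have "f * (b - g) \<in> supported Q" by (rule supported_mult[OF f b' PQ])
    ultimately have "(a - f) * b + f * (b - g) \<in> supported Q" by (rule supported_add)
    also have "(a - f) * b + f * (b - g) = a * b - f * g" by (simp add: algebra_simps)
    finally show ?thesis by (simp add: fps_coset_eq_iff supported_def)
  qed
  moreover have "f \<in> fps_coset Q1 f" "g \<in> fps_coset Q2 g" by (auto simp: fps_coset_def)
  ultimately show ?thesis
    unfolding rcoset_mult_def a_r_coset_series_ring series_ring_simps by blast
qed

text \<open>The sum in \<open>graded_product\<close> is taken in a quotient ring. The conditions on
  \<open>Q\<close> make \<open>supported Q\<close> an ideal, so the sum can be computed on
  representatives.\<close>

lemma (in additive_submonoid) finsum_fps_coset:
  fixes f :: "'i \<Rightarrow> 'a::comm_ring_1 fps"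
  assumes Q: "Q \<subseteq> S" "\<And>s t. s \<in> S \<Longrightarrow> t \<in> Q \<Longrightarrow> s + t \<in> Q"
    and "finite A" and f: "\<And>i. i \<in> A \<Longrightarrow> f i \<in> supported S"
    and x: "\<And>i. i \<in> A \<Longrightarrow> x i = fps_coset Q (f i)"
  shows "(\<Oplus>\<^bsub>series_ring S Quot supported Q\<^esub>i\<in>A. x i) = fps_coset Q (\<Sum>i\<in>A. f i)"
proof -
  let ?Q = "series_ring S Quot (supported Q :: 'a fps set)"
  interpret ideal "supported Q" "series_ring S :: 'a fps ring"
    by (rule ideal_supported) (use Q in auto)
  interpret Q: ring ?Q by (rule quotient_is_ring)
  have carr: "fps_coset Q g \<in> carrier ?Q" if "g \<in> supported S" for g :: "'a fps"
    using that by (auto simp: FactRing_def A_RCOSETS_def' a_r_coset_series_ring)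
  have add: "x \<oplus>\<^bsub>?Q\<^esub> y = x <+>\<^bsub>series_ring S\<^esub> y" for x y by (simp add: FactRing_def)
  have zero: "\<zero>\<^bsub>?Q\<^esub> = supported Q" by (simp add: FactRing_def)
  from assms(3,4) x show ?thesis
  proof induction
    case empty
    show ?case by (simp add: zero fps_coset_zero)
  next
    case (insert i A)
    then show ?case by (simp add: Pi_def carr add set_add_fps_coset)
  qed
qed

text \<open>
  The exponents of a monomial basis of \<open>\<Oplus>\<^sub>n P n / Q n\<close> are arranged in finitely many rays
  \<open>n m + w j\<close>, \<open>n \<ge> d j\<close>; each ray spans a copy of the polynomial ring in \<open>t\<^sup>m\<close>.
\<close>

locale graded_basis = additive_submonoid S for S +
  fixes P Q :: "nat \<Rightarrow> nat set" and J :: "'j set" and w d :: "'j \<Rightarrow> nat" and m :: nat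
  assumes Q_subset: "Q n \<subseteq> P n" and P_subset: "P n \<subseteq> S"
    and Q_add: "s \<in> S \<Longrightarrow> t \<in> Q n \<Longrightarrow> s + t \<in> Q n"
    and finite_J: "finite J" and inj_w: "inj_on w J"
    and P_diff_Q: "P n - Q n = {n * m + w j | j. j \<in> J \<and> d j \<le> n}"
begin

abbreviation quot :: "(nat \<Rightarrow> 'a::comm_ring_1 fps set, nat \<Rightarrow> 'a fps set) graded_module" where
  "quot \<equiv> graded_quotient (series_ring S) (\<lambda>n. supported (P n)) (\<lambda>n. supported (Q n))"

text \<open>The representative in degree \<open>n\<close> that uses basis monomials only. Ray
  \<open>j\<close> starts in degree \<open>d j\<close>, so its term in degree \<open>n\<close> comes
  from coefficient \<open>n - d j\<close>; the condition \<open>d j \<le> n\<close> excludes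
  truncated subtraction.\<close>

definition rep :: "('j \<Rightarrow> 'a::comm_ring_1 poly) \<Rightarrow> nat \<Rightarrow> 'a fps" where
  "rep y n = (\<Sum>j | j \<in> J \<and> d j \<le> n. fps_const (coeff (y j) (n - d j)) * fps_X ^ (n * m + w j))"

definition decode :: "('j \<Rightarrow> 'a::comm_ring_1 poly) \<Rightarrow> nat \<Rightarrow> 'a fps set" where
  "decode y n = fps_coset (Q n) (rep y n)"

lemma rep_nth:
  assumes "j \<in> J" "d j \<le> n"
  shows "fps_nth (rep y n) (n * m + w j) = coeff (y j) (n - d j)"
proof -
  have "fps_nth (rep y n) (n * m + w j) =
      (\<Sum>i | i \<in> J \<and> d i \<le> n. if i = j then coeff (y j) (n - d j) else 0)"
    unfolding rep_def fps_sum_nth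
    \<comment> \<open>By \<open>inj_w\<close>, different rays have different exponents in the same
      degree, so the terms do not collide.\<close>
    by (rule sum.cong) (use inj_w assms in \<open>auto simp: fps_X_power_nth dest: inj_onD\<close>)
  then show ?thesis using assms finite_J by simp
qed

lemma rep_supported_diff: "rep y n \<in> supported (P n - Q n)"
  unfolding rep_def P_diff_Q
  by (intro supported_sum supported_mult[where A = "{0}" and B = "(P n - Q n)"] fps_X_power_supported)
     (auto simp: supported_def P_diff_Q)

lemma rep_supported: "rep y n \<in> supported (P n)"
  using rep_supported_diff supported_mono[of "P n - Q n" "P n"] by blast

lemma decode_eq_iff:
  "decode y n = decode z n \<longleftrightarrow>
    (\<forall>j\<in>J. d j \<le> n \<longrightarrow> coeff (y j) (n - d j) = coeff (z j) (n - d j))"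
proof
  assume eq: "decode y n = decode z n"
  show "\<forall>j\<in>J. d j \<le> n \<longrightarrow> coeff (y j) (n - d j) = coeff (z j) (n - d j)"
  proof (intro ballI impI)
    fix j assume j: "j \<in> J" "d j \<le> n"
    then have "n * m + w j \<in> P n - Q n" using P_diff_Q by blast
    then have "fps_nth (rep y n) (n * m + w j) = fps_nth (rep z n) (n * m + w j)"
      using eq unfolding decode_def fps_coset_eq_iff by blast
    then show "coeff (y j) (n - d j) = coeff (z j) (n - d j)" using j by (simp add: rep_nth)
  qed
next
  assume "\<forall>j\<in>J. d j \<le> n \<longrightarrow> coeff (y j) (n - d j) = coeff (z j) (n - d j)"
  then have "rep y n = rep z n" unfolding rep_def by (intro sum.cong) auto
  then show "decode y n = decode z n" by (simp add: decode_def)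
qed

lemma decode_zero: "decode (\<lambda>_. 0) n = supported (Q n)"
  by (simp add: decode_def rep_def fps_coset_zero)

lemma decode_eq_zero_iff:
  "decode y n = supported (Q n) \<longleftrightarrow> (\<forall>j\<in>J. d j \<le> n \<longrightarrow> coeff (y j) (n - d j) = 0)"
  using decode_eq_iff[of y n "\<lambda>_. 0"] by (simp add: decode_zero)

lemma carrier_quot:
  "carrier quot = {x. (\<forall>n. \<exists>f\<in>supported (P n). x n = fps_coset (Q n) f) \<and>
    finite {n. x n \<noteq> supported (Q n)}}"
  by (auto simp: graded_quotient_def Let_def a_r_coset_series_ring image_iff)

lemma decode_carrier: "decode y \<in> carrier quot"
proof -
  have "{n. decode y n \<noteq> supported (Q n)} \<subseteq> {..\<Sum>j\<in>J. d j + degree (y j)}"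
  proof
    fix n assume "n \<in> {n. decode y n \<noteq> supported (Q n)}"
    then obtain j where j: "j \<in> J" "d j \<le> n" "coeff (y j) (n - d j) \<noteq> 0"
      by (auto simp: decode_eq_zero_iff)
    then have "n \<le> d j + degree (y j)" using le_degree[of "y j" "n - d j"] by simp
    also have "\<dots> \<le> (\<Sum>j\<in>J. d j + degree (y j))"
      using j(1) finite_J by (intro member_le_sum) auto
    finally show "n \<in> {..\<Sum>j\<in>J. d j + degree (y j)}" by simp
  qed
  then have "finite {n. decode y n \<noteq> supported (Q n)}" by (rule finite_subset) simp
  then show ?thesis using rep_supported unfolding carrier_quot by (auto simp: decode_def)
qed

lemma decode_surj:
  assumes x: "x \<in> carrier quot"
  shows "\<exists>y. x = decode y"
proof -
  from x obtain f where f: "\<And>n. f n \<in> supported (P n)" "\<And>n. x n = fps_coset (Q n) (f n)"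
    unfolding carrier_quot by (auto dest!: bchoice choice) metis
  from x have fin: "finite {n. x n \<noteq> supported (Q n)}" unfolding carrier_quot by simp
  then obtain N where N: "\<And>n. n > N \<Longrightarrow> x n = supported (Q n)"
    by (metis (mono_tags, lifting) Max_ge mem_Collect_eq not_less)
  \<comment> \<open>Coefficient \<open>i\<close> on ray \<open>j\<close> is read off in degree
    \<open>i + d j\<close>. That almost all components vanish makes \<open>c j\<close> a
    polynomial.\<close>
  define c where "c j i = fps_nth (f (i + d j)) ((i + d j) * m + w j)" for j i
  have c0: "c j i = 0" if "i > N" "j \<in> J" for i j
  proof -
    have "x (i + d j) = supported (Q (i + d j))" using N that by simp
    then have "fps_coset (Q (i + d j)) (f (i + d j)) = fps_coset (Q (i + d j)) 0"
      using f(2) fps_coset_zero by metis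
    moreover have "(i + d j) * m + w j \<in> P (i + d j) - Q (i + d j)"
      unfolding P_diff_Q using that by force
    ultimately show ?thesis unfolding fps_coset_eq_iff c_def by auto
  qed
  define y where "y = (\<lambda>j. Abs_poly (c j))"
  have y: "coeff (y j) i = c j i" if "j \<in> J" for i j
    unfolding y_def using that coeff_Abs_poly[of N "c j"] c0 by simp
  have "x n = decode y n" for n
    unfolding decode_def f(2) fps_coset_eq_iff
  proof (intro allI impI)
    fix k assume k: "k \<notin> Q n"
    show "fps_nth (f n) k = fps_nth (rep y n) k"
    proof (cases "k \<in> P n")
      case True
      then obtain j where "j \<in> J" "d j \<le> n" "k = n * m + w j"
        using k P_diff_Q[of n] by blast
      then show ?thesis by (simp add: rep_nth y c_def)
    next
      case False
      then show ?thesis using f(1)[of n] rep_supported[of y n] by (simp add: supported_def)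
    qed
  qed
  then show ?thesis by blast
qed

lemma decode_eq: "decode y = decode z \<longleftrightarrow> (\<forall>j\<in>J. y j = z j)"
proof
  assume eq: "decode y = decode z"
  have "coeff (y j) i = coeff (z j) i" if "j \<in> J" for i j
    using decode_eq_iff[of y "i + d j" z] eq that by auto
  then show "\<forall>j\<in>J. y j = z j" by (simp add: poly_eq_iff)
qed (simp add: fun_eq_iff decode_eq_iff)

lemma decode_add: "decode (\<lambda>j. y j + z j) = decode y \<oplus>\<^bsub>quot\<^esub> decode z"
proof
  fix n
  have "rep (\<lambda>j. y j + z j) n = rep y n + rep z n"
    unfolding rep_def
    by (simp add: sum.distrib[symmetric] fps_const_add[symmetric] algebra_simps del: fps_const_add)
  then show "decode (\<lambda>j. y j + z j) n = (decode y \<oplus>\<^bsub>quot\<^esub> decode z) n"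
    by (simp add: decode_def graded_quotient_def Let_def set_add_fps_coset)
qed

text \<open>The product of degree \<open>i\<close> of the scalar with degree \<open>n - i\<close> of
  ray \<open>j\<close> has exponent \<open>i * m + (n - i) * m + w j = n * m + w j\<close>,
  independent of \<open>i\<close>. After exchanging the sums, the coefficient at that exponent is
  the Cauchy product for \<open>p * y j\<close>.\<close>

lemma rep_smult:
  "(\<Sum>i\<le>n. (fps_const (coeff p i) * fps_X ^ (i * m)) * rep y (n - i)) = rep (\<lambda>j. p * y j) n"
proof -
  define t where "t i j = fps_const (coeff p i * coeff (y j) (n - d j - i)) * (fps_X :: 'a fps) ^ (n * m + w j)" for i j
  have "(\<Sum>i\<le>n. (fps_const (coeff p i) * fps_X ^ (i * m)) * rep y (n - i)) =
      (\<Sum>i\<le>n. \<Sum>j | j \<in> J \<and> d j \<le> n - i. t i j)"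
    unfolding rep_def sum_distrib_left
  proof (intro sum.cong refl)
    fix i j assume i: "i \<in> {..n}" and j: "j \<in> {j. j \<in> J \<and> d j \<le> n - i}"
    have "n * m + w j = i * m + ((n - i) * m + w j)"
      using i by (simp add: add_mult_distrib[symmetric] flip: add.assoc)
    moreover have "n - i - d j = n - d j - i" by simp
    ultimately show "fps_const (coeff p i) * fps_X ^ (i * m) *
        (fps_const (coeff (y j) (n - i - d j)) * fps_X ^ ((n - i) * m + w j)) = t i j"
      by (simp add: t_def power_add fps_const_mult[symmetric] mult_ac del: fps_const_mult)
  qed
  also have "\<dots> = (\<Sum>i\<le>n. \<Sum>j\<in>J. if d j \<le> n - i then t i j else 0)"
    using finite_J by (simp add: sum.inter_filter)
  also have "\<dots> = (\<Sum>j\<in>J. \<Sum>i\<le>n. if d j \<le> n - i then t i j else 0)"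
    by (rule sum.swap)
  also have "\<dots> = (\<Sum>j\<in>J. if d j \<le> n then \<Sum>i\<le>n - d j. t i j else 0)"
  proof (rule sum.cong[OF refl])
    fix j
    have "(\<Sum>i\<le>n. if d j \<le> n - i then t i j else 0) = (\<Sum>i | i \<in> {..n} \<and> d j \<le> n - i. t i j)"
      by (rule sum.inter_filter[symmetric]) simp
    also have "{i. i \<in> {..n} \<and> d j \<le> n - i} = (if d j \<le> n then {..n - d j} else {})" by auto
    finally show "(\<Sum>i\<le>n. if d j \<le> n - i then t i j else 0) = (if d j \<le> n then \<Sum>i\<le>n - d j. t i j else 0)"
      by simp
  qed
  also have "\<dots> = (\<Sum>j | j \<in> J \<and> d j \<le> n. \<Sum>i\<le>n - d j. t i j)"
    using finite_J by (simp add: sum.inter_filter)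
  also have "\<dots> = rep (\<lambda>j. p * y j) n"
    unfolding rep_def t_def coeff_mult sum_distrib_right[symmetric]
    by (simp add: fps_const_sum)
  finally show ?thesis .
qed

text \<open>\<open>P1\<close> and \<open>Q1\<close> give the filtration from which the scalars come:
  those of the fiber cone, acting on itself or on the tangent cone. The hypotheses on sums of
  exponents make products of classes well defined.\<close>

lemma decode_smult:
  assumes P1: "\<And>n. n * m \<in> P1 n"
    and P1_Q: "\<And>i k a b. a \<in> P1 i \<Longrightarrow> b \<in> Q k \<Longrightarrow> a + b \<in> Q (i + k)"
    and Q1_P: "\<And>i k a b. a \<in> Q1 i \<Longrightarrow> b \<in> P k \<Longrightarrow> a + b \<in> Q (i + k)"
    and P1_P: "\<And>i k a b. a \<in> P1 i \<Longrightarrow> b \<in> P k \<Longrightarrow> a + b \<in> S"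
    and x: "\<And>n. x n = fps_coset (Q1 n) (fps_const (coeff p n) * fps_X ^ (n * m))"
  shows "graded_product (series_ring S) (\<lambda>n. supported (Q n)) x (decode y) = decode (\<lambda>j. p * y j)"
proof
  fix n
  let ?f = "\<lambda>i. fps_const (coeff p i) * fps_X ^ (i * m)"
  have f: "?f i \<in> supported (P1 i)" for i
    using P1 by (intro supported_mult[where A = "{0}" and B = "{i * m}"] fps_X_power_supported)
      (auto simp: supported_def)
  have "rcoset_mult (series_ring S) (supported (Q n)) (x i) (decode y (n - i)) =
      fps_coset (Q n) (?f i * rep y (n - i))" if "i \<le> n" for i
    unfolding x decode_def
  proof (rule rcoset_mult_fps_coset[OF f rep_supported _ _ Q_subset])
    show "a \<in> P1 i \<Longrightarrow> b \<in> Q (n - i) \<Longrightarrow> a + b \<in> Q n" for a b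
      using P1_Q[of a i b "n - i"] that by simp
    show "a \<in> Q1 i \<Longrightarrow> b \<in> P (n - i) \<Longrightarrow> a + b \<in> Q n" for a b
      using Q1_P[of a i b "n - i"] that by simp
  qed
  moreover have "?f i * rep y (n - i) \<in> supported S" for i
    by (rule supported_mult[OF f rep_supported P1_P])
  ultimately have "graded_product (series_ring S) (\<lambda>n. supported (Q n)) x (decode y) n =
      fps_coset (Q n) (\<Sum>i\<le>n. ?f i * rep y (n - i))"
    unfolding graded_product_def
    using Q_add Q_subset P_subset
    by (intro finsum_fps_coset) (blast | simp)+
  then show "graded_product (series_ring S) (\<lambda>n. supported (Q n)) x (decode y) n =
      decode (\<lambda>j. p * y j) n"
    by (simp add: rep_smult decode_def)
qed

lemma decode_component_iff:
  "decode y \<in> component quot n \<longleftrightarrow> (\<forall>j\<in>J. \<forall>i. coeff (y j) i \<noteq> 0 \<longrightarrow> i + d j = n)"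
proof -
  have "decode y \<in> component quot n \<longleftrightarrow> (\<forall>k. k \<noteq> n \<longrightarrow> decode y k = supported (Q k))"
    using decode_carrier[of y] by (simp add: graded_quotient_def Let_def)
  \<comment> \<open>Degrees \<open>k \<ge> d j\<close> are rewritten as
    \<open>k = i + d j\<close>.\<close>
  also have "\<dots> \<longleftrightarrow> (\<forall>j\<in>J. \<forall>i. coeff (y j) i \<noteq> 0 \<longrightarrow> i + d j = n)"
    unfolding decode_eq_zero_iff by (metis add_diff_cancel_right' le_add2 le_add_diff_inverse2)
  finally show ?thesis .
qed

lemma component_subset: "component quot n \<subseteq> carrier quot"
  by (auto simp: graded_quotient_def Let_def)

lemma graded_coordinates_decode:
  fixes \<phi> :: "'a::comm_ring_1 poly \<Rightarrow> nat \<Rightarrow> 'a fps set"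
  assumes "\<And>n. n * m \<in> P1 n"
    and "\<And>i k a b. a \<in> P1 i \<Longrightarrow> b \<in> Q k \<Longrightarrow> a + b \<in> Q (i + k)"
    and "\<And>i k a b. a \<in> Q1 i \<Longrightarrow> b \<in> P k \<Longrightarrow> a + b \<in> Q (i + k)"
    and "\<And>i k a b. a \<in> P1 i \<Longrightarrow> b \<in> P k \<Longrightarrow> a + b \<in> S"
    and "\<And>p n. \<phi> p n = fps_coset (Q1 n) (fps_const (coeff p n) * fps_X ^ (n * m))"
  shows "graded_coordinates \<phi> quot J d decode"
proof
  show "carrier quot = range (decode :: ('j \<Rightarrow> 'a poly) \<Rightarrow> _)"
    using decode_carrier decode_surj by blast
  show "decode y = decode z \<longleftrightarrow> (\<forall>j\<in>J. y j = z j)" for y z :: "'j \<Rightarrow> 'a poly"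
    by (rule decode_eq)
  show "decode y \<oplus>\<^bsub>quot\<^esub> decode z = decode (\<lambda>j. y j + z j)" for y z :: "'j \<Rightarrow> 'a poly"
    by (rule decode_add[symmetric])
  show "\<phi> p \<odot>\<^bsub>quot\<^esub> decode y = decode (\<lambda>j. p * y j)" for p y
    using decode_smult[OF assms] by (simp add: graded_quotient_def Let_def)
  show "\<zero>\<^bsub>quot\<^esub> = decode (\<lambda>_. 0 :: 'a poly)"
    by (rule ext) (simp add: decode_zero graded_quotient_def Let_def)
  show "component quot n = decode ` {y :: 'j \<Rightarrow> 'a poly. \<forall>j\<in>J. \<forall>i. coeff (y j) i \<noteq> 0 \<longrightarrow> i + d j = n}" for n
  proof (intro equalityI subsetI)
    fix x :: "nat \<Rightarrow> 'a fps set" assume x: "x \<in> component quot n"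
    then obtain y where "x = decode y" using component_subset decode_surj by blast
    then show "x \<in> decode ` {y. \<forall>j\<in>J. \<forall>i. coeff (y j) i \<noteq> 0 \<longrightarrow> i + d j = n}"
      using x by (auto simp: decode_component_iff)
  qed (auto simp: decode_component_iff)
qed

end

section \<open>The numerical semigroup\<close>

text \<open>
  Since \<open>m\<^sub>1 = m\<^sub>0 + (2h - 1)\<close>, \<open>m\<^sub>2 = m\<^sub>0 + 4h\<close> and \<open>m\<^sub>3 = m\<^sub>0 + (2h - 1) + 4h\<close>, the sums of \<open>k\<close> generators
  are the numbers \<open>k m\<^sub>0 + a (2h - 1) + b 4h\<close> with \<open>a, b \<le> k\<close>.
\<close>

definition point :: "nat \<Rightarrow> nat \<Rightarrow> nat \<Rightarrow> nat \<Rightarrow> nat" where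
  "point h k a b = k * (2 * h * (2 * h - 1)) + a * (2 * h - 1) + b * (4 * h)"

definition level :: "nat \<Rightarrow> nat \<Rightarrow> nat set" where
  "level h n = {point h k a b | k a b. n \<le> k \<and> a \<le> k \<and> b \<le> k}"

lemma point_add: "point h k a b + point h k' a' b' = point h (k + k') (a + a') (b + b')"
  by (simp add: point_def add_mult_distrib)

lemma level_add: "s \<in> level h n \<Longrightarrow> t \<in> level h n' \<Longrightarrow> s + t \<in> level h (n + n')"
  unfolding level_def by (auto simp: point_add) (metis add_mono)

lemma level_mono: "n \<le> n' \<Longrightarrow> level h n' \<subseteq> level h n"
  by (auto simp: level_def intro: order_trans)

text \<open>Carrying: \<open>2 * h\<close> copies of \<open>2 * h - 1\<close> make one
  \<open>m0\<close>, and \<open>2 * h - 1\<close> copies of \<open>4 * h\<close> make two.\<close>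

lemma point_normal_form:
  assumes "h \<ge> 1"
  shows "point h k a b =
    point h (k + a div (2 * h) + 2 * (b div (2 * h - 1))) (a mod (2 * h)) (b mod (2 * h - 1))"
proof -
  define p where "p = 2 * h - 1"
  obtain a1 a2 where a: "a1 = a div (2 * h)" "a2 = a mod (2 * h)" by blast
  obtain b1 b2 where b: "b1 = b div p" "b2 = b mod p" by blast
  have "a = a1 * (2 * h) + a2" "b = b1 * p + b2" by (simp_all only: a b div_mult_mod_eq)
  then show ?thesis
    unfolding point_def p_def[symmetric] a[symmetric] b[symmetric] by (simp add: algebra_simps)
qed

text \<open>Modulo \<open>p = 2 * h - 1\<close> one has \<open>4 * h = 2 * (p + 1)\<close>, so the
  point is congruent to \<open>2 * b\<close>; as \<open>p\<close> is odd, this determines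
  \<open>b\<close>. After cancelling \<open>p\<close>, the numbers \<open>k\<close> and
  \<open>a\<close> are quotient and remainder of a division by \<open>2 * h\<close>.\<close>

lemma point_inj:
  assumes h: "h \<ge> 1" and eq: "point h k a b = point h k' a' b'"
    and "a < 2 * h" "a' < 2 * h" "b < 2 * h - 1" "b' < 2 * h - 1"
  shows "k = k' \<and> a = a' \<and> b = b'"
proof -
  define p where "p = 2 * h - 1"
  have p: "2 * h = p + 1" using h by (simp add: p_def)
  have q: "4 * h = 2 * (p + 1)" using p by simp
  have e: "point h k a b = (k * (2 * h) + a + 2 * b) * p + 2 * b" for k a b
    unfolding point_def p_def[symmetric] q by (simp add: algebra_simps)
  have "[2 * b = 2 * b'] (mod p)"
    using eq unfolding e cong_def by (metis mod_mult_self3)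
  moreover have "coprime 2 p" using h by (simp add: p_def)
  ultimately have "[b = b'] (mod p)" by (simp add: cong_mult_lcancel_nat)
  then have b: "b = b'" using assms(5,6) by (simp add: cong_def p_def)
  then have "(k * (2 * h) + a) * p = (k' * (2 * h) + a') * p"
    using eq unfolding e by (simp add: add_mult_distrib)
  then have ka: "k * (2 * h) + a = k' * (2 * h) + a'" using h by (simp add: p_def)
  have "k = (k * (2 * h) + a) div (2 * h)" "k' = (k' * (2 * h) + a') div (2 * h)"
    using assms(3,4) h by simp_all
  then show ?thesis using ka b by simp
qed

lemma level_diff:
  assumes h: "h \<ge> 1"
  shows "level h n - level h (n + 1) =
    {point h n a b | a b. a < 2 * h \<and> b < 2 * h - 1 \<and> a \<le> n \<and> b \<le> n}"
proof -
  \<comment> \<open>Carrying raises \<open>k\<close> and lowers \<open>a\<close> and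
    \<open>b\<close>, so the bounds by \<open>k\<close> survive. The claim is stated for arbitrary
    \<open>n\<close>, since it is also used at \<open>n + 1\<close> below.\<close>
  have normal: "\<exists>k a b. s = point h k a b \<and> n \<le> k \<and> a \<le> k \<and> b \<le> k \<and> a < 2 * h \<and> b < 2 * h - 1"
    if s_level: "s \<in> level h n" for s n
  proof -
    obtain k a b where s: "s = point h k a b" "n \<le> k" "a \<le> k" "b \<le> k"
      using s_level unfolding level_def by blast
    have "a mod (2 * h) \<le> a" "b mod (2 * h - 1) \<le> b" by simp_all
    moreover have "a mod (2 * h) < 2 * h" "b mod (2 * h - 1) < 2 * h - 1" using h by simp_all
    moreover have "s = point h (k + a div (2 * h) + 2 * (b div (2 * h - 1))) (a mod (2 * h)) (b mod (2 * h - 1))"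
      unfolding s(1) by (rule point_normal_form[OF h])
    ultimately show ?thesis
      using s(2-4)
      by (intro exI[of _ "k + a div (2 * h) + 2 * (b div (2 * h - 1))"]
          exI[of _ "a mod (2 * h)"] exI[of _ "b mod (2 * h - 1)"]) linarith
  qed
  show ?thesis
  proof (intro equalityI subsetI)
    fix s assume s: "s \<in> level h n - level h (n + 1)"
    then obtain k a b where k: "s = point h k a b" "n \<le> k" "a \<le> k" "b \<le> k" "a < 2 * h" "b < 2 * h - 1"
      using normal[of s n] by auto
    have "point h k a b \<in> level h (n + 1)" if "n + 1 \<le> k"
      using k(3,4) that unfolding level_def by blast
    then have "k = n" using s k(1,2) by fastforce
    then show "s \<in> {point h n a b | a b. a < 2 * h \<and> b < 2 * h - 1 \<and> a \<le> n \<and> b \<le> n}"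
      using k by blast
  next
    fix s assume "s \<in> {point h n a b | a b. a < 2 * h \<and> b < 2 * h - 1 \<and> a \<le> n \<and> b \<le> n}"
    then obtain a b where s: "s = point h n a b" "a < 2 * h" "b < 2 * h - 1" "a \<le> n" "b \<le> n" by blast
    then have "s \<in> level h n" by (auto simp: level_def)
    moreover have "s \<notin> level h (n + 1)"
    proof
      assume "s \<in> level h (n + 1)"
      then obtain k a' b' where "s = point h k a' b'" "n + 1 \<le> k" "a' < 2 * h" "b' < 2 * h - 1"
        using normal by blast
      then show False using point_inj[OF h, of n a b k a' b'] s by simp
    qed
    ultimately show "s \<in> level h n - level h (n + 1)" by blast
  qed
qed

text \<open>One generator is split off, taking a unit from each of \<open>a\<close> and
  \<open>b\<close> that is positive, so that the rest stays below \<open>k - 1\<close>. The four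
  generators thus form the finite set required by \<open>ideal_prod_supported\<close>.\<close>

lemma level_Suc_split:
  assumes "s \<in> level h (n + 1)"
  shows "\<exists>e\<in>{point h 1 a b | a b. a \<le> 1 \<and> b \<le> 1}. \<exists>t\<in>level h n. s = t + e"
proof -
  obtain k a b where s: "s = point h k a b" "n + 1 \<le> k" "a \<le> k" "b \<le> k"
    using assms by (auto simp: level_def)
  have "s = point h (k - 1) (a - min a 1) (b - min b 1) + point h 1 (min a 1) (min b 1)"
    unfolding point_add using s by simp
  moreover have "point h (k - 1) (a - min a 1) (b - min b 1) \<in> level h n"
    unfolding level_def using s
    by (intro CollectI exI[of _ "k - 1"] exI[of _ "a - min a 1"] exI[of _ "b - min b 1"]) auto
  moreover have "point h 1 (min a 1) (min b 1) \<in> {point h 1 a b | a b. a \<le> 1 \<and> b \<le> 1}"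
    by (intro CollectI exI[of _ "min a 1"] exI[of _ "min b 1"]) auto
  ultimately show ?thesis by blast
qed

lemma level_0_eq_generated:
  assumes "h \<ge> 1"
  shows "level h 0 = {n. \<exists>e. length e = length [point h 1 0 0, point h 1 1 0, point h 1 0 1, point h 1 1 1] \<and>
    (\<Sum>i<length [point h 1 0 0, point h 1 1 0, point h 1 0 1, point h 1 1 1].
      e ! i * [point h 1 0 0, point h 1 1 0, point h 1 0 1, point h 1 1 1] ! i) = n}"
proof -
  have sum4: "(\<Sum>i<length [m0, m1, m2, m3]. e ! i * [m0, m1, m2, m3] ! i) =
      e ! 0 * m0 + e ! 1 * m1 + e ! 2 * m2 + e ! 3 * m3" for e :: "nat list" and m0 m1 m2 m3
    by (simp add: eval_nat_numeral)
  have gen: "e0 * point h 1 0 0 + e1 * point h 1 1 0 + e2 * point h 1 0 1 + e3 * point h 1 1 1 =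
      point h (e0 + e1 + e2 + e3) (e1 + e3) (e2 + e3)" for e0 e1 e2 e3
    by (simp add: point_def add_mult_distrib add_mult_distrib2)
  show ?thesis
    unfolding sum4 gen
  proof (intro equalityI subsetI)
    fix s assume "s \<in> level h 0"
    then obtain k a b where s: "s = point h k a b" "a \<le> k" "b \<le> k" by (auto simp: level_def)
    \<comment> \<open>The smaller of \<open>a\<close> and \<open>b\<close> counts copies of the last
      generator, which contributes to both; the excess is made up by the second or third generator,
      and copies of the first bring the total to \<open>k\<close>.\<close>
    define e where "e = (if a \<le> b then [k - b, 0, b - a, a] else [k - a, a - b, 0, b])"
    have "length e = 4" "e ! 0 + e ! 1 + e ! 2 + e ! 3 = k" "e ! 1 + e ! 3 = a" "e ! 2 + e ! 3 = b"
      using s by (auto simp: e_def eval_nat_numeral)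
    then show "s \<in> {n. \<exists>e. length e = length [point h 1 0 0, point h 1 1 0, point h 1 0 1, point h 1 1 1] \<and>
        point h (e ! 0 + e ! 1 + e ! 2 + e ! 3) (e ! 1 + e ! 3) (e ! 2 + e ! 3) = n}"
      using s(1) by (intro CollectI exI[of _ e]) auto
  qed (force simp: level_def)
qed

text \<open>Pairs are sorted by \<open>k = max a b\<close>. For \<open>k \<le> 2 * h - 2\<close>
  these are \<open>(k, i)\<close> with \<open>i \<le> k\<close> and \<open>(i, k)\<close> with
  \<open>i < k\<close>, in total \<open>2 * k + 1\<close>; \<open>k = 0\<close> gives the single
  pair \<open>(0, 0)\<close>, the class of 1. For \<open>a = 2 * h - 1\<close> there is one pair for
  each of the \<open>2 * h - 1\<close> values of \<open>b\<close>.\<close>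

lemma bij_betw_summands:
  fixes h :: nat
  assumes "h \<ge> 1"
  shows "bij_betw
    (case_sum (\<lambda>(k, i, u). if i \<le> k then (k, i) else (i - k - 1, k)) (\<lambda>(i, u). (2 * h - 1, i)))
    (Sum_Type.Plus (SIGMA k:{0..2 * h - 2}. {..<2 * k + 1} \<times> (UNIV :: unit set))
      ({..<2 * h - 1} \<times> (UNIV :: unit set)))
    ({..<2 * h} \<times> {..<2 * h - 1})"
  by (rule bij_betw_byWitness[where f' = "\<lambda>(a, b). if a = 2 * h - 1 then Inr (b, ())
      else if b \<le> a then Inl (a, b, ()) else Inl (b, a + b + 1, ())"])
    (use assms in \<open>auto split: if_splits\<close>)

lemma additive_submonoid_level: "additive_submonoid (level h 0)"
proof
  show "0 \<in> level h 0" by (auto simp: level_def point_def intro!: exI[of _ 0])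
  show "a \<in> level h 0 \<Longrightarrow> b \<in> level h 0 \<Longrightarrow> a + b \<in> level h 0" for a b
    using level_add[of a h 0 b 0] by simp
qed

lemma level_minus_zero:
  assumes "h \<ge> 1"
  shows "level h 0 - {0} = level h 1"
proof -
  have "level h 0 - level h 1 = {0}" using level_diff[of h 0] assms by (auto simp: point_def)
  then show ?thesis using level_mono[of 0 1 h] by auto
qed

section \<open>Monomial bases of the fiber cone and the tangent cone\<close>

text \<open>Only the exponent 0 lies outside \<open>level h 1\<close>, so in each degree
  \<open>n\<close> just the multiple \<open>n * m0\<close> survives. Hence there is a single ray
  starting in degree 0, which is the structure of a polynomial ring in one variable.\<close>

lemma graded_basis_fiber_cone:
  assumes h: "h \<ge> 1"
  shows "graded_basis (level h 0) (\<lambda>n. (+) (n * point h 1 0 0) ` level h 0)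
    (\<lambda>n. (+) (n * point h 1 0 0) ` level h 1) (UNIV :: unit set) (\<lambda>_. 0) (\<lambda>_. 0) (point h 1 0 0)"
proof -
  interpret additive_submonoid "level h 0" by (rule additive_submonoid_level)
  have m: "n * point h 1 0 0 = point h n 0 0" for n by (simp add: point_def)
  have mem: "n * point h 1 0 0 \<in> level h 0" for n unfolding m by (auto simp: level_def)
  show ?thesis
  proof
    fix n
    show "(+) (n * point h 1 0 0) ` level h 1 \<subseteq> (+) (n * point h 1 0 0) ` level h 0"
      using level_mono[of 0 1 h] by auto
    show "(+) (n * point h 1 0 0) ` level h 0 \<subseteq> level h 0"
      using add_mem[OF mem] by auto
    show "s + t \<in> (+) (n * point h 1 0 0) ` level h 1"
      if s: "s \<in> level h 0" and t: "t \<in> (+) (n * point h 1 0 0) ` level h 1" for s t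
    proof -
      from t obtain u where u: "u \<in> level h 1" "t = n * point h 1 0 0 + u" by auto
      then have "s + u \<in> level h 1" using level_add[OF s u(1)] by simp
      then show ?thesis using u(2) by (intro image_eqI[of _ _ "s + u"]) auto
    qed
    have "(+) (n * point h 1 0 0) ` level h 0 - (+) (n * point h 1 0 0) ` level h 1 =
        (+) (n * point h 1 0 0) ` (level h 0 - level h 1)"
      by (rule image_set_diff[symmetric]) simp
    also have "level h 0 - level h 1 = {0}"
      using level_minus_zero[OF h] zero_mem by auto
    finally show "(+) (n * point h 1 0 0) ` level h 0 - (+) (n * point h 1 0 0) ` level h 1 =
        {n * point h 1 0 0 + 0 | j. j \<in> (UNIV :: unit set) \<and> 0 \<le> n}"
      by simp
  qed (simp_all add: inj_on_def)
qed

text \<open>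
  A pair \<open>(a, b)\<close> stands for the element \<open>point h (max a b) a b\<close> of the Apery set with respect to \<open>m\<^sub>0\<close>;
  it has order \<open>max a b\<close>.
\<close>

lemma graded_basis_tangent_cone:
  assumes h: "h \<ge> 1"
  shows "graded_basis (level h 0) (level h) (\<lambda>n. level h (n + 1)) ({..<2 * h} \<times> {..<2 * h - 1})
    (\<lambda>(a, b). point h 0 a b) (\<lambda>(a, b). max a b) (point h 1 0 0)"
proof -
  interpret additive_submonoid "level h 0" by (rule additive_submonoid_level)
  show ?thesis
  proof
    fix n
    show "level h (n + 1) \<subseteq> level h n" "level h n \<subseteq> level h 0" by (auto intro!: level_mono)
    show "s + t \<in> level h (n + 1)" if "s \<in> level h 0" "t \<in> level h (n + 1)" for s t
      using level_add[OF that] by simp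
    show "inj_on (\<lambda>(a, b). point h 0 a b) ({..<2 * h} \<times> {..<2 * h - 1})"
      by (auto simp: inj_on_def dest!: point_inj[OF h])
    \<comment> \<open>\<open>point h 0 a b\<close> is the ray of \<open>(a, b)\<close> extrapolated
      down to degree 0; it need not lie in the semigroup, and the ray enters it in degree
      \<open>max a b\<close>.\<close>
    have "n * point h 1 0 0 + point h 0 a b = point h n a b" for a b by (simp add: point_def)
    then show "level h n - level h (n + 1) =
        {n * point h 1 0 0 + (case j of (a, b) \<Rightarrow> point h 0 a b) | j.
          j \<in> {..<2 * h} \<times> {..<2 * h - 1} \<and> (case j of (a, b) \<Rightarrow> max a b) \<le> n}"
      unfolding level_diff[OF h] by auto
  qed simp_all
qed

lemma level_ideal_power:
  "ideal_power (series_ring (level h 0)) (supported (level h 1)) n =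
    (supported (level h n) :: 'a::comm_ring_1 fps set)"
proof (induction n)
  case 0
  show ?case by (subst ideal_power_0) simp
next
  case (Suc n)
  interpret additive_submonoid "level h 0" by (rule additive_submonoid_level)
  let ?E = "{point h 1 a b | a b. a \<le> 1 \<and> b \<le> 1}"
  have "?E = (\<lambda>(a, b). point h 1 a b) ` ({..1} \<times> {..1})" by auto
  then have "finite ?E" by simp
  moreover have "?E \<subseteq> level h 1" by (auto simp: level_def)
  ultimately have "supported (level h n) \<cdot>\<^bsub>series_ring (level h 0)\<^esub> supported (level h 1) =
      (supported (level h (n + 1)) :: 'a fps set)"
    by (intro ideal_prod_supported[where E = ?E] level_add level_Suc_split)
  then show ?case unfolding ideal_power_Suc Suc by simp
qed

theorem corollary3p6:
  fixes h m0 m1 m2 m3 :: nat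
    and R :: "'k::field fps ring"
    and \<mm> I :: "'k fps set"
    and F G :: "(nat \<Rightarrow> 'k fps set, nat \<Rightarrow> 'k fps set) graded_module"
  assumes "h \<ge> 2"
    and "m0 = 2 * h * (2 * h - 1)"
    and "m1 = (2 * h + 1) * (2 * h - 1)"
    and "m2 = 2 * h * (2 * h + 1)"
    and "m3 = 2 * h * (2 * h + 1) + (2 * h - 1)"
    and "R = power_series_subring [m0, m1, m2, m3]"
    and "maximalideal \<mm> R"
    and "I = Idl\<^bsub>R\<^esub> {fps_X ^ m0}"
    and "F = fiber_cone R \<mm> I"
    and "G = tangent_cone R \<mm>"
  shows "free_module F G \<and>
    graded_isomorphic F G
      (graded_sum
        (graded_Sum {0..2 * h - 2} (\<lambda>k. graded_power (graded_shift F k) (2 * k + 1)))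
        (graded_power (graded_shift F (2 * h - 1)) (2 * h - 1)))"
proof -
  have h: "h \<ge> 1" using assms(1) by simp
  let ?S = "level h 0"
  interpret additive_submonoid ?S by (rule additive_submonoid_level)
  \<comment> \<open>Rewriting \<open>2 * h\<close> as \<open>p + 1\<close> removes truncated
    subtraction from the identities for the generators.\<close>
  define p where "p = 2 * h - 1"
  have p: "2 * h = p + 1" "4 * h = 2 * p + 2" using h by (simp_all add: p_def)
  have gens: "m0 = point h 1 0 0" "m1 = point h 1 1 0" "m2 = point h 1 0 1" "m3 = point h 1 1 1"
    unfolding assms(2-5) point_def p_def[symmetric] p by (simp_all add: algebra_simps)
  have pos: "[m0, m1, m2, m3] ! i > 0" if "i < length [m0, m1, m2, m3]" for i
    using that h assms(2-5) by (auto simp: less_Suc_eq)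
  have R: "R = series_ring ?S"
    using power_series_subring_eq[OF pos] unfolding assms(6) level_0_eq_generated[OF h] gens by simp
  have \<mm>: "\<mm> = supported (level h 1)"
    using maximal_ideal_eq assms(7) unfolding R level_minus_zero[OF h] by blast
  have m0: "m0 \<in> ?S" unfolding gens by (auto simp: level_def)
  have I: "I = supported ((+) m0 ` ?S)"
    unfolding assms(8) R by (rule genideal_fps_X_power[OF m0])
  have nm0: "n * m0 = point h n 0 0" for n by (simp add: gens point_def)
  have nm0_mem: "n * m0 \<in> level h n" for n unfolding nm0 by (auto simp: level_def)
  \<comment> \<open>The exponents of the \<open>n\<close>-th power of \<open>I\<close>, and of its
    product with the maximal ideal.\<close>
  define PF QF where "PF n = (+) (n * m0) ` ?S" and "QF n = (+) (n * m0) ` level h 1" for n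
  have PF: "ideal_power R I n = supported (PF n)" for n
    unfolding R I PF_def by (rule translate_ideal_power[OF m0])
  have QF: "\<mm> \<cdot>\<^bsub>R\<^esub> supported (PF n) = supported (QF n)" for n
  proof -
    have "s + t \<in> level h 1" if "s \<in> ?S" "t \<in> level h 1" for s t
      using level_add[OF that] by simp
    moreover have "n * m0 \<in> ?S" using nm0_mem[of n] level_mono[of 0 n h] by auto
    ultimately show ?thesis
      unfolding R \<mm> PF_def QF_def by (intro supported_ideal_prod_translate)
  qed
  interpret FB: graded_basis ?S PF QF "UNIV :: unit set" "\<lambda>_. 0" "\<lambda>_. 0" m0
    unfolding PF_def QF_def gens by (rule graded_basis_fiber_cone[OF h])
  interpret GB: graded_basis ?S "level h" "\<lambda>n. level h (n + 1)" "{..<2 * h} \<times> {..<2 * h - 1}"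
    "\<lambda>(a, b). point h 0 a b" "\<lambda>(a, b). max a b" m0
    unfolding gens by (rule graded_basis_tangent_cone[OF h])
  have F: "F = FB.quot" unfolding assms(9) fiber_cone_def PF QF unfolding R ..
  have G: "G = GB.quot"
    unfolding assms(10) tangent_cone_def R \<mm> level_ideal_power ..
  \<comment> \<open>The identification of the polynomial ring with the fiber cone: the
    \<open>n\<close>-th power of the variable goes to the class of
    \<open>fps_X ^ (n * m0)\<close>.\<close>
  define \<phi> :: "'k poly \<Rightarrow> nat \<Rightarrow> 'k fps set" where "\<phi> p = FB.decode (\<lambda>_. p)" for p
  have \<phi>: "\<phi> p n = fps_coset (QF n) (fps_const (coeff p n) * fps_X ^ (n * m0))" for p n
    unfolding \<phi>_def FB.decode_def FB.rep_def by (simp add: UNIV_unit)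
  \<comment> \<open>This and the next fact express that the \<open>i\<close>-th power of
    \<open>I\<close> lies in the \<open>i\<close>-th power of the maximal ideal, and its product
    with the maximal ideal in the next power, so the action on the tangent cone is well
    defined.\<close>
  have PF_level: "a + b \<in> level h (i + k)" if "a \<in> PF i" "b \<in> level h k" for a b i k
  proof -
    have "a \<in> level h i" using that(1) level_add[OF nm0_mem, of _ 0 i] by (auto simp: PF_def)
    then show ?thesis using level_add that(2) by blast
  qed
  have QF_level: "a + b \<in> level h (i + k + 1)" if "a \<in> QF i" "b \<in> level h k" for a b i k
  proof -
    have "a \<in> level h (i + 1)" using that(1) level_add[OF nm0_mem, of _ 1 i] by (auto simp: QF_def)
    then show ?thesis using level_add[of a h "i + 1" b k] that(2) by simp
  qed
  have coord_G: "graded_coordinates \<phi> G ({..<2 * h} \<times> {..<2 * h - 1}) (\<lambda>(a, b). max a b) GB.decode"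
    unfolding G
  proof (rule GB.graded_coordinates_decode[OF _ _ _ _ \<phi>])
    show "n * m0 \<in> PF n" for n unfolding PF_def using zero_mem by (force intro: image_eqI[of _ _ 0])
    fix i k a b
    show "a \<in> PF i \<Longrightarrow> b \<in> level h (k + 1) \<Longrightarrow> a + b \<in> level h (i + k + 1)"
      using PF_level[of a i b "k + 1"] by simp
    show "a \<in> QF i \<Longrightarrow> b \<in> level h k \<Longrightarrow> a + b \<in> level h (i + k + 1)" by (rule QF_level)
    show "a \<in> PF i \<Longrightarrow> b \<in> level h k \<Longrightarrow> a + b \<in> ?S"
      using PF_level level_mono[of 0 "i + k" h] by blast
  qed
  have coord_F: "graded_coordinates \<phi> F (UNIV :: unit set) (\<lambda>_. 0) FB.decode"
    unfolding F
  proof (rule FB.graded_coordinates_decode[OF _ _ _ _ \<phi>])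
    show "n * m0 \<in> PF n" for n unfolding PF_def using zero_mem by (force intro: image_eqI[of _ _ 0])
    fix i k a b
    show "a + b \<in> QF (i + k)" if ab: "a \<in> PF i" "b \<in> QF k"
    proof -
      from ab obtain s t where st: "s \<in> ?S" "t \<in> level h 1" "a = i * m0 + s" "b = k * m0 + t"
        by (auto simp: PF_def QF_def)
      then have "s + t \<in> level h 1" using level_add[of s h 0 t 1] by simp
      then show ?thesis unfolding QF_def st
        by (intro image_eqI[of _ _ "s + t"]) (simp_all add: algebra_simps)
    qed
    then show "a + b \<in> QF (i + k)" if ab: "a \<in> QF i" "b \<in> PF k"
    proof -
      from ab obtain s t where st: "s \<in> level h 1" "t \<in> ?S" "a = i * m0 + s" "b = k * m0 + t"
        by (auto simp: PF_def QF_def)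
      then have "s + t \<in> level h 1" using level_add[of s h 1 t 0] by simp
      then show ?thesis unfolding QF_def st
        by (intro image_eqI[of _ _ "s + t"]) (simp_all add: algebra_simps)
    qed
    show "a \<in> PF i \<Longrightarrow> b \<in> PF k \<Longrightarrow> a + b \<in> ?S"
      using FB.P_subset add_mem by blast
  qed
  interpret CF: graded_coordinates \<phi> F "UNIV :: unit set" "\<lambda>_. 0" FB.decode by (rule coord_F)
  \<comment> \<open>A coordinate function on a one-element index set is a single polynomial.\<close>
  have unit_fun: "y = (\<lambda>_. y ())" for y :: "unit \<Rightarrow> 'k poly" by auto
  have scalars: "scalar_iso F \<phi>"
  proof
    show "bij_betw \<phi> UNIV (carrier F)"
      unfolding bij_betw_def CF.carrier_eq
    proof
      show "inj \<phi>" by (auto simp: inj_def \<phi>_def CF.eq_iff)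
      show "range \<phi> = range FB.decode" 
      proof
        show "range FB.decode \<subseteq> range \<phi>"
        proof
          fix x assume "x \<in> range (FB.decode :: (unit \<Rightarrow> 'k poly) \<Rightarrow> _)"
          then obtain y :: "unit \<Rightarrow> 'k poly" where "x = FB.decode y" by blast
          then have "x = \<phi> (y ())" unfolding \<phi>_def using unit_fun[of y] by simp
          then show "x \<in> range \<phi>" by blast
        qed
      qed (auto simp: \<phi>_def)
    qed
    show "\<phi> p \<oplus>\<^bsub>F\<^esub> \<phi> q = \<phi> (p + q)" for p q by (simp add: \<phi>_def CF.add)
    \<comment> \<open>Multiplication and scalar action of \<open>F\<close> are the same
      \<open>graded_product\<close>, so the module coordinates of \<open>F\<close> over itself also
      yield its ring structure.\<close>
    have "\<phi> p \<otimes>\<^bsub>F\<^esub> x = \<phi> p \<odot>\<^bsub>F\<^esub> x" for p x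
      by (simp add: F graded_quotient_def Let_def)
    then show "\<phi> p \<otimes>\<^bsub>F\<^esub> \<phi> q = \<phi> (p * q)" for p q
      using CF.smult[of p "\<lambda>_. q"] by (simp add: \<phi>_def)
    show "\<zero>\<^bsub>F\<^esub> = \<phi> 0" by (simp add: \<phi>_def CF.zero)
    show "\<one>\<^bsub>F\<^esub> = \<phi> 1"
      by (rule ext) (auto simp: \<phi> F graded_quotient_def Let_def a_r_coset_series_ring fps_coset_zero)
  qed
  have power: "graded_coordinates \<phi> (graded_power (graded_shift F k) r)
      ({..<r} \<times> (UNIV :: unit set)) (\<lambda>(i, u). 0 + k) (\<lambda>y. \<lambda>i\<in>{..<r}. FB.decode (\<lambda>j. y (i, j)))" for k r
    unfolding graded_power_def
    by (rule graded_coordinates_Sum[OF finite_lessThan CF.graded_coordinates_shift])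
  note target = graded_coordinates_sum[OF graded_coordinates_Sum[OF finite_atLeastAtMost power] power]
  have "graded_isomorphic F G
      (graded_sum
        (graded_Sum {0..2 * h - 2} (\<lambda>k. graded_power (graded_shift F k) (2 * k + 1)))
        (graded_power (graded_shift F (2 * h - 1)) (2 * h - 1)))"
    \<comment> \<open>What remains is that the bijection respects degrees: the pair matched with a
      basis element of the summand shifted by \<open>k\<close> has maximum \<open>k\<close>.\<close>
    by (rule graded_isomorphic_coordinates[OF coord_G target
          scalar_iso.scalar_carrier[OF scalars] bij_betw_summands[OF h]])
      (auto split: if_splits)
  moreover have "free_module F G"
    by (rule graded_coordinates.free_module_coordinates[OF coord_G scalars]) simp
  ultimately show ?thesis by blast
qed

end
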